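(* Let $m\ge 2$ and $n_1,\dots,n_m$ be positive integers, and let $G=K_{2n_1,2n_2,\dots,2n_m}$ be the complete $m$-partite graph with parts of sizes $2n_1,\dots,2n_m$. Let $n=n_1+\cdots+n_m$ and $e=\sum_{1\le i<j\le m} n_in_j$. Then \[\theta(4,G)=\left\lceil \frac{e}{n-1}\right\rceil.\]
   Context: The girth of a graph is the length of its shortest cycle, or $\infty$ if it is acyclic. The $4$-girth-thickness $\theta(4,H)$ of a graph $H$ is the minimum number of planar subgraphs of girth at least $4$ (i.e. triangle-free planar subgraphs) whose union is $H$. *)

theory Defs
  imports "HOL-Analysis.Analysis" "HOL-Library.Extended_Nat"
begin

type_synonym 'a ugraph = "'a set \<times> 'a set set"

abbreviation verts :: "'a ugraph \<Rightarrow> 'a set" where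
  "verts G \<equiv> fst G"

abbreviation edges :: "'a ugraph \<Rightarrow> 'a set set" where
  "edges G \<equiv> snd G"

definition simple_graph :: "'a ugraph \<Rightarrow> bool" where
  "simple_graph G \<longleftrightarrow> finite (verts G) \<and> (\<forall>e\<in>edges G. e \<subseteq> verts G \<and> card e = 2)"

definition subgraph :: "'a ugraph \<Rightarrow> 'a ugraph \<Rightarrow> bool" where
  "subgraph H G \<longleftrightarrow> simple_graph H \<and> verts H \<subseteq> verts G \<and> edges H \<subseteq> edges G"

definition is_cycle :: "'a ugraph \<Rightarrow> 'a list \<Rightarrow> bool" where
  "is_cycle G c \<longleftrightarrow> 3 \<le> length c \<and> distinct c \<and>
     (\<forall>i<length c. {c ! i, c ! (Suc i mod length c)} \<in> edges G)"

text \<open>The infimum of the empty set in \<^typ>\<open>enat\<close> is \<open>\<infinity>\<close>, as required for acyclic graphs.\<close>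

definition girth :: "'a ugraph \<Rightarrow> enat" where
  "girth G = (INF c\<in>{c. is_cycle G c}. enat (length c))"

text \<open>
  Planarity is topological: \<open>p\<close> places the vertices at distinct points of the plane
  (identified with \<^typ>\<open>complex\<close>), and \<open>\<gamma> e\<close> draws the edge \<open>e\<close> as an arc joining its two
  endpoints, passing through no other vertex and meeting other edges only in common endpoints.
\<close>

definition planar_drawing ::
  "'a ugraph \<Rightarrow> ('a \<Rightarrow> complex) \<Rightarrow> ('a set \<Rightarrow> real \<Rightarrow> complex) \<Rightarrow> bool" where
  "planar_drawing G p \<gamma> \<longleftrightarrow>
     inj_on p (verts G) \<and>
     (\<forall>e\<in>edges G. arc (\<gamma> e) \<and> {pathstart (\<gamma> e), pathfinish (\<gamma> e)} = p ` e \<and>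
        path_image (\<gamma> e) \<inter> p ` verts G = p ` e) \<and>
     (\<forall>e\<in>edges G. \<forall>f\<in>edges G. e \<noteq> f \<longrightarrow>
        path_image (\<gamma> e) \<inter> path_image (\<gamma> f) = p ` (e \<inter> f))"

definition planar :: "'a ugraph \<Rightarrow> bool" where
  "planar G \<longleftrightarrow> (\<exists>p \<gamma>. planar_drawing G p \<gamma>)"

definition planar_girth_decomposition :: "nat \<Rightarrow> 'a ugraph \<Rightarrow> nat \<Rightarrow> (nat \<Rightarrow> 'a ugraph) \<Rightarrow> bool" where
  "planar_girth_decomposition g G k H \<longleftrightarrow>
     (\<forall>i<k. subgraph (H i) G \<and> planar (H i) \<and> enat g \<le> girth (H i)) \<and>
     (\<Union>i<k. verts (H i)) = verts G \<and> (\<Union>i<k. edges (H i)) = edges G"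

text \<open>
  The infimum is attained whenever a decomposition exists, and is \<open>\<infinity>\<close> otherwise.
\<close>

definition girth_thickness :: "nat \<Rightarrow> 'a ugraph \<Rightarrow> enat" where
  "girth_thickness g G = (INF k\<in>{k. \<exists>H. planar_girth_decomposition g G k H}. enat k)"

text \<open>The vertex \<open>(i, k)\<close> is the \<open>k\<close>-th vertex of the \<open>i\<close>-th part, which has \<open>s i\<close> vertices.\<close>

definition complete_multipartite :: "nat \<Rightarrow> (nat \<Rightarrow> nat) \<Rightarrow> (nat \<times> nat) ugraph" where
  "complete_multipartite m s =
     (let V = (SIGMA i:{1..m}. {1..s i}) in (V, {{u, v} | u v. u \<in> V \<and> v \<in> V \<and> fst u \<noteq> fst v}))"

lemma simple_graph_complete_multipartite: "simple_graph (complete_multipartite m s)"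
  by (auto simp: simple_graph_def complete_multipartite_def Let_def card_2_iff)

end

theory Submission
  imports Defs "HOL-Analysis.Finite_Function_Topology"
begin

text \<open>
  \<^emph>\<open>Lower bound.\<close> A triangle-free plane graph on \<open>N \<ge> 3\<close> vertices has at most \<open>2 N - 4\<close> edges, and
  \<open>K_{2n_1,...,2n_m}\<close> has \<open>2 n\<close> vertices and \<open>4 e\<close> edges. For topological drawings the edge bound is
  obtained as follows. Adding an edge between connected vertices splits a face by the Jordan curve
  theorem, so there are at least \<open>E - N + 2\<close> faces; by Janiszewski's theorem it splits it into two
  faces only, while an edge between different components splits nothing. Hence every edge borders at
  most two faces, and every face is bordered by the edges of a cycle, i.e. by at least four edges.

  \<^emph>\<open>Upper bound.\<close> Replacing each vertex of a forest by two independent copies gives a planar graph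
  without triangles, so it suffices to cover \<open>K_{n_1,...,n_m}\<close> by \<open>\<lceil>e / (n - 1)\<rceil>\<close> forests. By the
  theorem of Nash-Williams this is possible if every vertex set \<open>C\<close> spans at most \<open>k (|C| - 1)\<close>
  edges, and for a complete multipartite graph the whole vertex set is the worst case. Forests are
  treated as linearly independent sets of vectors \<open>u - v\<close>, one for each edge.
\<close>

section \<open>Covering vectors by independent sets\<close>

text \<open>The two bounds meet in one graph. A spanning tree of \<open>K_{n_1,...,n_m}\<close> has
  \<open>n - 1\<close> edges, and doubling the vertices turns each edge into a 4-cycle. This gives
  \<open>4 (n - 1) = 2 (2 n) - 4\<close> edges, the maximum for a triangle-free plane graph on
  \<open>2 n\<close> vertices. Here the even part sizes enter. Euler's formula enters as an
  inequality: \<open>F >= E - N + 2\<close> and \<open>4 F <= 2 E\<close> already give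
  \<open>E <= 2 N - 4\<close>. Faces are counted through finite sets of points lying in pairwise
  different faces, so everything about them is a statement on connectedness in the complement of the
  drawing. Linear independence stands for acyclicity because exchanges can then be followed through
  spans: the vectors that can be exchanged are read off from coordinates, and the rank of an edge
  set is a dimension.\<close>

lemma in_span_exchangeable:
  fixes B :: "'v::real_vector set"
  assumes B: "independent B" and e: "e \<in> span B" "e \<notin> B"
  shows "e \<in> span {b \<in> B. independent (insert e (B - {b}))}"
proof -
  \<comment> \<open>Every vector with a nonzero coefficient at \<open>e\<close> can be exchanged: if
    \<open>e\<close> were in the span of the others, uniqueness of the representation would make
    this coefficient vanish.\<close>
  have supp: "b \<in> B \<and> independent (insert e (B - {b}))" if b: "representation B e b \<noteq> 0" for b
  proof -
    have "b \<in> B"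
      using b by (rule representation_ne_zero)
    moreover have "e \<notin> span (B - {b})"
    proof
      assume "e \<in> span (B - {b})"
      then have "representation B e = representation (B - {b}) e"
        using representation_extend[OF B] by auto
      then show False
        using b representation_ne_zero[of "B - {b}" e b] by auto
    qed
    moreover have "independent (B - {b})"
      using B by (rule independent_mono) auto
    ultimately show ?thesis
      by (simp add: independent_insert)
  qed
  have "e = (\<Sum>b | representation B e b \<noteq> 0. representation B e b *\<^sub>R b)"
    using sum_nonzero_representation_eq[OF B e(1)] by simp
  also have "\<dots> \<in> span {b \<in> B. independent (insert e (B - {b}))}"
    by (intro span_sum span_scale span_base) (use supp in auto)
  finally show ?thesis .
qed

text \<open>Disjointness makes the sum of the sizes the number of covered vectors, so a packing of
  maximal size leaves as few vectors uncovered as possible.\<close>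

definition independent_packing :: "'v::real_vector set \<Rightarrow> nat \<Rightarrow> (nat \<Rightarrow> 'v set) \<Rightarrow> bool" where
  "independent_packing E k F \<longleftrightarrow>
     (\<forall>i<k. F i \<subseteq> E \<and> independent (F i)) \<and> disjoint_family_on F {..<k}"

definition exchange_step :: "'v::real_vector set \<Rightarrow> nat \<Rightarrow> (nat \<Rightarrow> 'v set) \<Rightarrow> (nat \<Rightarrow> 'v set) \<Rightarrow> bool" where
  "exchange_step E k F F' \<longleftrightarrow> (\<exists>i e b. i < k \<and> e \<in> E - (\<Union>j<k. F j) \<and> b \<in> F i \<and>
     independent (insert e (F i - {b})) \<and> F' = F(i := insert e (F i - {b})))"

text \<open>Since \<open>e\<close> lies in no \<open>F j\<close>, trading it for \<open>b\<close>
  keeps the sets disjoint and the size equal. Hence exchanges that start at a packing of maximal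
  size reach only such packings.\<close>

lemma exchange_step_packing:
  assumes "finite E" "independent_packing E k F" "exchange_step E k F F'"
  shows "independent_packing E k F' \<and> (\<Sum>j<k. card (F' j)) = (\<Sum>j<k. card (F j))"
proof -
  obtain i e b where i: "i < k" and e: "e \<in> E" "\<And>j. j < k \<Longrightarrow> e \<notin> F j" and b: "b \<in> F i"
    and ind: "independent (insert e (F i - {b}))" and F': "F' = F(i := insert e (F i - {b}))"
    using assms(3) unfolding exchange_step_def by auto
  have sub: "\<And>j. j < k \<Longrightarrow> F j \<subseteq> E"
    and disj: "\<And>j l. j < k \<Longrightarrow> l < k \<Longrightarrow> j \<noteq> l \<Longrightarrow> F j \<inter> F l = {}"
    using assms(2) unfolding independent_packing_def disjoint_family_on_def by auto
  have "disjoint_family_on F' {..<k}"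
    unfolding disjoint_family_on_def
  proof (intro ballI impI)
    fix j l assume "j \<in> {..<k}" "l \<in> {..<k}" "j \<noteq> l"
    then show "F' j \<inter> F' l = {}"
      using disj[of j l] e(2)[of j] e(2)[of l] unfolding F' by auto
  qed
  moreover have "\<forall>j<k. F' j \<subseteq> E \<and> independent (F' j)"
    using assms(2) ind e(1) sub[OF i] unfolding F' independent_packing_def by auto
  moreover have "card (F' j) = card (F j)" if "j < k" for j
  proof (cases "j = i")
    case True
    have "finite (F i)"
      using sub[OF i] assms(1) finite_subset by blast
    then have "card (insert e (F i - {b})) = card (F i)"
      using e(2)[OF i] card_Suc_Diff1[OF _ b] by (simp del: card_Diff_singleton)
    then show ?thesis
      by (simp add: True F')
  qed (simp add: F')
  ultimately show ?thesis
    by (simp add: independent_packing_def)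
qed

text \<open>
  Take a packing of maximal total size. Let \<open>R\<close> be the set of vectors left uncovered by some
  packing that is reachable by exchanges. The span of \<open>F i \<inter> R\<close> is invariant under exchanges
  and contains \<open>R\<close>, so an uncovered vector would give \<open>card R > k * dim R\<close>.
\<close>

theorem independent_cover:
  fixes E :: "'v::real_vector set"
  assumes fin: "finite E" and dense: "\<And>R. R \<subseteq> E \<Longrightarrow> card R \<le> k * dim R"
  shows "\<exists>F. (\<forall>i<k. F i \<subseteq> E \<and> independent (F i)) \<and> (\<Union>i<k. F i) = E"
proof -
  let ?size = "\<lambda>F. \<Sum>i<k. card (F i :: 'v set)"
  have "\<exists>F. independent_packing E k F \<and> (\<forall>G. independent_packing E k G \<longrightarrow> ?size G \<le> ?size F)"
  proof (rule ex_has_greatest_nat[where f = "\<lambda>F. ?size F"])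
    show "independent_packing E k (\<lambda>_. {})"
      by (auto simp: independent_packing_def disjoint_family_on_def independent_empty)
    show "\<forall>F. independent_packing E k F \<longrightarrow> ?size F < Suc (k * card E)"
    proof (intro allI impI)
      fix F :: "nat \<Rightarrow> 'v set" assume "independent_packing E k F"
      then have "?size F \<le> (\<Sum>i<k. card E)"
        by (intro sum_mono card_mono) (auto simp: independent_packing_def fin)
      then show "?size F < Suc (k * card E)"
        by simp
    qed
  qed
  then obtain F0 where F0: "independent_packing E k F0"
    and max0: "\<And>G. independent_packing E k G \<Longrightarrow> ?size G \<le> ?size F0"
    by blast
  define reach where "reach = (exchange_step E k)\<^sup>*\<^sup>* F0"
  have reach: "independent_packing E k F \<and> ?size F = ?size F0" if "reach F" for F
    using that unfolding reach_def
  proof (induction rule: rtranclp_induct)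
    case base
    then show ?case using F0 by simp
  next
    case (step F F')
    then show ?case using exchange_step_packing[OF fin] by metis
  qed
  define R where "R = {e \<in> E. \<exists>F. reach F \<and> e \<notin> (\<Union>j<k. F j)}"
  \<comment> \<open>Maximality forces \<open>e\<close> into \<open>span (F i)\<close>. The vectors
    of \<open>F i\<close> that can be exchanged for \<open>e\<close> already span it, and each is
    uncovered after its exchange, hence lies in \<open>R\<close>.\<close>
  have uncovered: "e \<in> span (F i \<inter> R)"
    if F: "reach F" and e: "e \<in> E" "e \<notin> (\<Union>j<k. F j)" and i: "i < k" for F e i
  proof -
    have pack: "independent_packing E k F" and size: "?size F = ?size F0"
      using reach[OF F] by auto
    have ind: "independent (F i)" and eFi: "e \<notin> F i" and finFi: "finite (F i)"
      using pack i e fin by (auto simp: independent_packing_def intro: finite_subset)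
    have "e \<in> span (F i)"
    proof (rule ccontr)
      assume "e \<notin> span (F i)"
      then have "independent (insert e (F i))"
        using ind by (rule independent_insertI)
      then have "independent_packing E k (F(i := insert e (F i)))"
        using pack e i unfolding independent_packing_def disjoint_family_on_def by auto
      then have "?size (F(i := insert e (F i))) \<le> ?size F"
        using max0 size by metis
      moreover have "?size (F(i := insert e (F i))) = Suc (?size F)"
      proof -
        have "?size (F(i := insert e (F i))) =
            card (insert e (F i)) + (\<Sum>j\<in>{..<k} - {i}. card ((F(i := insert e (F i))) j))"
          using i by (subst sum.remove[of _ i]) auto
        also have "(\<Sum>j\<in>{..<k} - {i}. card ((F(i := insert e (F i))) j)) = (\<Sum>j\<in>{..<k} - {i}. card (F j))"
          by (rule sum.cong) auto
        also have "card (insert e (F i)) + (\<Sum>j\<in>{..<k} - {i}. card (F j)) = Suc (?size F)"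
          using i eFi finFi by (subst (2) sum.remove[of _ i]) auto
        finally show ?thesis .
      qed
      ultimately show False by simp
    qed
    then have "e \<in> span {b \<in> F i. independent (insert e (F i - {b}))}"
      using in_span_exchangeable[OF ind _ eFi] by blast
    moreover have "{b \<in> F i. independent (insert e (F i - {b}))} \<subseteq> F i \<inter> R"
    proof
      fix b assume "b \<in> {b \<in> F i. independent (insert e (F i - {b}))}"
      then have b: "b \<in> F i" "independent (insert e (F i - {b}))"
        by auto
      let ?F' = "F(i := insert e (F i - {b}))"
      have "exchange_step E k F ?F'"
        unfolding exchange_step_def using i e b by blast
      then have "reach ?F'"
        using F unfolding reach_def by (rule rtranclp.rtrancl_into_rtrancl[rotated])
      moreover have "b \<notin> ?F' j" if "j < k" for j
      proof (cases "j = i")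
        case False
        then have "F j \<inter> F i = {}"
          using that i pack by (simp add: independent_packing_def disjoint_family_on_def)
        then show ?thesis
          using False b(1) by auto
      qed (use b(1) eFi in auto)
      moreover have "b \<in> E"
        using pack i b(1) by (auto simp: independent_packing_def)
      ultimately show "b \<in> F i \<inter> R"
        unfolding R_def using b(1) by blast
    qed
    ultimately show ?thesis
      using span_mono by blast
  qed
  have span_eq: "span (F i \<inter> R) = span (F0 i \<inter> R)" if "reach F" "i < k" for F i
    using that(1) unfolding reach_def
  proof (induction rule: rtranclp_induct)
    case base
    show ?case ..
  next
    case (step F F')
    have F: "reach F" and F': "reach F'"
      using step unfolding reach_def by auto
    obtain l e b where l: "l < k" and e: "e \<in> E" "e \<notin> (\<Union>j<k. F j)" and b: "b \<in> F l"
      and F'_eq: "F' = F(l := insert e (F l - {b}))"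
      using step.hyps(2) unfolding exchange_step_def by blast
    have pack: "independent_packing E k F"
      using reach[OF F] by simp
    have bE: "b \<in> E"
      using l b pack by (auto simp: independent_packing_def)
    have "b \<notin> F j" if "j < k" "j \<noteq> l" for j
    proof -
      have "F j \<inter> F l = {}"
        using that l pack by (simp add: independent_packing_def disjoint_family_on_def)
      then show ?thesis using b by auto
    qed
    then have bF': "b \<notin> (\<Union>j<k. F' j)"
      using l b e unfolding F'_eq by auto
    \<comment> \<open>Only \<open>F l\<close> changes. Before the step \<open>e\<close> is
      uncovered, after it \<open>b\<close> is, so \<open>uncovered\<close> puts each of them into
      the span belonging to the other packing.\<close>
    have "span (F' i \<inter> R) = span (F i \<inter> R)"
    proof (cases "i = l")
      case True
      have "e \<in> span (F l \<inter> R)" "b \<in> span (F' l \<inter> R)"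
        using uncovered[OF F e l] uncovered[OF F' bE bF' l] by auto
      then have "F' l \<inter> R \<subseteq> span (F l \<inter> R)" "F l \<inter> R \<subseteq> span (F' l \<inter> R)"
        by (auto simp: F'_eq intro: span_base)
      then show ?thesis
        unfolding True by (meson span_minimal subspace_span subset_antisym)
    qed (simp add: F'_eq)
    then show ?case
      using step.IH by simp
  qed
  have "(\<Union>i<k. F0 i) = E"
  proof (rule ccontr)
    assume "(\<Union>i<k. F0 i) \<noteq> E"
    moreover have "(\<Union>i<k. F0 i) \<subseteq> E"
      using F0 by (auto simp: independent_packing_def)
    ultimately obtain e0 where e0: "e0 \<in> E" "e0 \<notin> (\<Union>i<k. F0 i)"
      by blast
    have "reach F0"
      by (simp add: reach_def)
    then have e0R: "e0 \<in> R"
      unfolding R_def using e0 by blast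
    have finR: "finite R"
      unfolding R_def using fin by simp
    \<comment> \<open>Each \<open>F0 i\<close> contains a basis of the span of \<open>R\<close>. By
      disjointness this makes \<open>k * dim R\<close> covered vectors of \<open>R\<close>, and
      \<open>e0\<close> is one more.\<close>
    have "card (F0 i \<inter> R) = dim R" if i: "i < k" for i
    proof (rule basis_card_eq_dim)
      show "R \<subseteq> span (F0 i \<inter> R)"
      proof
        fix e assume "e \<in> R"
        then obtain F where "reach F" "e \<in> E" "e \<notin> (\<Union>j<k. F j)"
          unfolding R_def by blast
        then show "e \<in> span (F0 i \<inter> R)"
          using uncovered span_eq i by metis
      qed
      show "independent (F0 i \<inter> R)"
        using F0 i by (meson independent_packing_def independent_mono Int_lower1)
    qed auto
    then have "k * dim R = (\<Sum>i<k. card (F0 i \<inter> R))"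
      by simp
    also have "\<dots> = card (\<Union>i<k. F0 i \<inter> R)"
    proof (rule card_UN_disjoint[symmetric])
      show "\<forall>i\<in>{..<k}. \<forall>j\<in>{..<k}. i \<noteq> j \<longrightarrow> F0 i \<inter> R \<inter> (F0 j \<inter> R) = {}"
        using F0 unfolding independent_packing_def disjoint_family_on_def by blast
    qed (use finR in auto)
    also have "\<dots> < card R"
      using e0 e0R finR by (intro psubset_card_mono) auto
    finally show False
      using dense[of R] by (auto simp: R_def)
  qed
  then show ?thesis
    using F0 by (intro exI[of _ F0]) (auto simp: independent_packing_def)
qed

section \<open>Covering graphs by forests\<close>

text \<open>Acyclicity by counting: a cycle has as many edges as vertices and would violate the
  inequality. This form passes to subsets at once, yields leaves by a degree sum and excludes
  triangles directly.\<close>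

definition forest :: "'a set set \<Rightarrow> bool" where
  "forest S \<longleftrightarrow> finite S \<and> (\<forall>e\<in>S. card e = 2) \<and> (\<forall>T\<subseteq>S. T \<noteq> {} \<longrightarrow> card T < card (\<Union>T))"

text \<open>Finitely supported functions form the free real vector space on the vertices, whatever
  their type.\<close>

abbreviation unit_vec :: "'a \<Rightarrow> 'a \<Rightarrow>\<^sub>0 real" where
  "unit_vec v \<equiv> Poly_Mapping.single v 1"

lemma independent_unit_vecs: "independent (unit_vec ` V)"
proof
  assume "dependent (unit_vec ` V)"
  then obtain v where v: "v \<in> V" "unit_vec v \<in> span (unit_vec ` V - {unit_vec v})"
    by (auto simp: dependent_def)
  have "subspace {x :: 'a \<Rightarrow>\<^sub>0 real. Poly_Mapping.lookup x v = 0}"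
    by (auto simp: subspace_def lookup_add scaleR_poly_mapping_def)
  moreover have "unit_vec ` V - {unit_vec v} \<subseteq> {x. Poly_Mapping.lookup x v = 0}"
    by (auto simp: lookup_single when_def)
  ultimately have "unit_vec v \<in> {x. Poly_Mapping.lookup x v = 0}"
    using v(2) span_minimal by blast
  then show False by simp
qed

lemma inj_unit_vec: "inj (unit_vec :: 'a \<Rightarrow> 'a \<Rightarrow>\<^sub>0 real)"
  by (rule injI) (metis lookup_single_eq lookup_single_not_eq zero_neq_one)

text \<open>A column of the oriented incidence matrix. The choice fixes only a sign, which affects
  neither spans nor independence.\<close>

definition edge_vec :: "'a set \<Rightarrow> 'a \<Rightarrow>\<^sub>0 real" where
  "edge_vec e = (SOME x. \<exists>u v. e = {u, v} \<and> u \<noteq> v \<and> x = unit_vec u - unit_vec v)"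

lemma edge_vec_pair:
  assumes "u \<noteq> v"
  shows "edge_vec {u, v} = unit_vec u - unit_vec v \<or> edge_vec {u, v} = unit_vec v - unit_vec u"
proof -
  have "\<exists>a b. {u, v} = {a, b} \<and> a \<noteq> b \<and> edge_vec {u, v} = unit_vec a - unit_vec b"
    unfolding edge_vec_def using assms by (intro someI_ex[of "\<lambda>x. \<exists>a b. {u, v} = {a, b} \<and> a \<noteq> b \<and> x = unit_vec a - unit_vec b"]) blast
  then show ?thesis
    by (auto simp: doubleton_eq_iff)
qed

text \<open>The support recovers the edge, which makes \<open>edge_vec\<close> injective and lets
  edges be counted as vectors.\<close>

lemma keys_edge_vec:
  assumes "card e = 2"
  shows "Poly_Mapping.keys (edge_vec e) = e"
proof -
  obtain u v where e: "e = {u, v}" "u \<noteq> v"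
    using assms by (auto simp: card_2_iff)
  have "Poly_Mapping.keys (unit_vec a - unit_vec b :: 'a \<Rightarrow>\<^sub>0 real) = {a, b}" if "a \<noteq> b" for a b
    using that by (auto simp: in_keys_iff lookup_minus lookup_single when_def split: if_splits)
  then show ?thesis
    using edge_vec_pair[OF e(2)] e by auto
qed

lemma inj_edge_vec: "\<forall>e\<in>E. card e = 2 \<Longrightarrow> inj_on edge_vec E"
  by (rule inj_on_inverseI[of _ Poly_Mapping.keys]) (auto simp: keys_edge_vec)

text \<open>The vectors of the edges in \<open>T\<close> lie in the span of the differences against
  one fixed vertex \<open>v0\<close>. There is one such difference for each other vertex of
  \<open>T\<close>, so independence bounds the number of edges.\<close>

lemma independent_edge_vecs_forest:
  assumes ind: "independent (edge_vec ` S)" and S: "finite S" "\<forall>e\<in>S. card e = 2"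
  shows "forest S"
  unfolding forest_def
proof (intro conjI allI impI)
  fix T assume T: "T \<subseteq> S" "T \<noteq> {}"
  have two: "\<forall>e\<in>T. card e = 2"
    using T S by auto
  have finU: "finite (\<Union>T)"
    using T S two by (metis card.infinite finite_Union finite_subset zero_neq_numeral)
  have "\<Union>T \<noteq> {}"
    using T two by (metis Sup_bot_conv(1) card.empty ex_in_conv zero_neq_numeral)
  then obtain v0 where v0: "v0 \<in> \<Union>T" by blast
  define B where "B = (\<lambda>v. unit_vec v - unit_vec v0) ` (\<Union>T - {v0})"
  have B: "unit_vec v - unit_vec v0 \<in> span B" if "v \<in> \<Union>T" for v
    using that by (cases "v = v0") (auto simp: B_def span_zero intro!: span_base)
  have "edge_vec ` T \<subseteq> span B"
  proof
    fix x assume "x \<in> edge_vec ` T"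
    then obtain e where e: "e \<in> T" "x = edge_vec e" by blast
    then obtain u v where uv: "e = {u, v}" "u \<noteq> v"
      using two by (meson card_2_iff)
    have u: "unit_vec u - unit_vec v0 \<in> span B" and v: "unit_vec v - unit_vec v0 \<in> span B"
      using e uv by (auto intro!: B)
    show "x \<in> span B"
      using span_diff[OF u v] span_diff[OF v u] edge_vec_pair[OF uv(2)] e uv by auto
  qed
  moreover have "independent (edge_vec ` T)"
    using ind T by (meson image_mono independent_mono)
  ultimately have "card (edge_vec ` T) \<le> card B"
    using independent_span_bound[of B "edge_vec ` T"] finU by (auto simp: B_def)
  also have "card B \<le> card (\<Union>T - {v0})"
    unfolding B_def using finU by (intro card_image_le) auto
  also have "\<dots> < card (\<Union>T)"
    using finU v0 by (rule card_Diff1_less)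
  finally show "card T < card (\<Union>T)"
    using inj_edge_vec[OF two] by (simp add: card_image)
qed (use S in auto)

text \<open>
  Two vertices are equivalent if the difference of their unit vectors lies in the span of \<open>R\<close>, i.e.
  if they lie in the same component of \<open>R\<close>; the edge bound is applied to each class.
\<close>

lemma edge_vecs_dense:
  assumes V: "finite V" and E: "\<And>e. e \<in> E \<Longrightarrow> e \<subseteq> V \<and> card e = 2"
    and dense: "\<And>C. C \<subseteq> V \<Longrightarrow> C \<noteq> {} \<Longrightarrow> card {e \<in> E. e \<subseteq> C} \<le> k * (card C - 1)"
    and R: "R \<subseteq> E"
  shows "card R \<le> k * dim (edge_vec ` R)"
proof -
  define sim where "sim u v \<longleftrightarrow> unit_vec u - unit_vec v \<in> span (edge_vec ` R)" for u v
  have sim_refl: "sim u u" for u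
    by (simp add: sim_def span_zero)
  have sim_sym: "sim u v \<Longrightarrow> sim v u" for u v
    unfolding sim_def by (metis minus_diff_eq span_neg)
  have sim_trans: "sim u v \<Longrightarrow> sim v w \<Longrightarrow> sim u w" for u v w
    unfolding sim_def by (metis (no_types, lifting) diff_add_cancel diff_diff_eq2 add_diff_eq span_add)
  define rep where "rep u = (SOME v. v \<in> V \<and> sim u v)" for u
  have rep: "rep u \<in> V" "sim u (rep u)" if "u \<in> V" for u
    using someI[of "\<lambda>v. v \<in> V \<and> sim u v" u] that sim_refl by (auto simp: rep_def)
  have rep_eq: "rep u = rep v" if "sim u v" for u v
  proof -
    have "(\<lambda>w. w \<in> V \<and> sim u w) = (\<lambda>w. w \<in> V \<and> sim v w)"
      using that sim_sym sim_trans by blast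
    then show ?thesis by (simp add: rep_def)
  qed
  have finE: "finite E"
    using V E by (meson PowI finite_Pow_iff finite_subset subsetI)
  have finR: "finite R"
    using finE R finite_subset by blast
  define cls where "cls r = {v \<in> V. rep v = r}" for r
  have cls: "cls r \<subseteq> V" "cls r \<noteq> {}" if "r \<in> rep ` V" for r
    using that by (auto simp: cls_def)
  have "R \<subseteq> (\<Union>r\<in>rep ` V. {e \<in> E. e \<subseteq> cls r})"
  proof
    fix e assume e: "e \<in> R"
    then obtain u v where uv: "e = {u, v}" "u \<noteq> v" "u \<in> V" "v \<in> V"
      using E R by (metis card_2_iff insert_subset subsetD)
    have "edge_vec e \<in> span (edge_vec ` R)"
      using e by (auto intro: span_base)
    then have "sim u v"
      using edge_vec_pair[OF uv(2)] sim_sym uv(1) unfolding sim_def by metis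
    then have "rep u = rep v"
      by (rule rep_eq)
    then show "e \<in> (\<Union>r\<in>rep ` V. {e \<in> E. e \<subseteq> cls r})"
      using uv e R by (auto simp: cls_def)
  qed
  then have "card R \<le> card (\<Union>r\<in>rep ` V. {e \<in> E. e \<subseteq> cls r})"
    using finE V by (intro card_mono) auto
  also have "\<dots> \<le> (\<Sum>r\<in>rep ` V. card {e \<in> E. e \<subseteq> cls r})"
    using V by (intro card_UN_le) auto
  also have "\<dots> \<le> (\<Sum>r\<in>rep ` V. k * (card (cls r) - 1))"
    using cls by (intro sum_mono dense) auto
  also have "\<dots> = k * (\<Sum>r\<in>rep ` V. card (cls r) - 1)"
    by (simp add: sum_distrib_left)
  also have "\<dots> \<le> k * dim (edge_vec ` R)"
  proof (rule mult_le_mono2)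
    have "(\<Sum>r\<in>rep ` V. card (cls r) - 1) + card (rep ` V) = (\<Sum>r\<in>rep ` V. (card (cls r) - 1) + 1)"
      by (subst sum.distrib) simp
    also have "\<dots> = (\<Sum>r\<in>rep ` V. card (cls r))"
    proof (rule sum.cong)
      fix r assume "r \<in> rep ` V"
      then have "card (cls r) \<noteq> 0"
        using cls V by (metis card_0_eq finite_subset)
      then show "card (cls r) - 1 + 1 = card (cls r)" by simp
    qed simp
    also have "\<dots> = card V"
      unfolding cls_def card_eq_sum by (rule sum.image_gen[OF V, symmetric])
    finally have sum: "(\<Sum>r\<in>rep ` V. card (cls r) - 1) + card (rep ` V) = card V" .
    obtain T where T: "T \<subseteq> edge_vec ` R" "edge_vec ` R \<subseteq> span T" "card T = dim (edge_vec ` R)"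
      using basis_exists by metis
    have finT: "finite T"
      using T(1) finR finite_subset by blast
    have sub: "unit_vec ` V \<subseteq> span (T \<union> unit_vec ` rep ` V)"
    proof
      fix x assume "x \<in> unit_vec ` V"
      then obtain v where v: "v \<in> V" "x = unit_vec v" by blast
      have "span (edge_vec ` R) \<subseteq> span T"
        using T(2) by (simp add: span_minimal)
      then have "unit_vec v - unit_vec (rep v) \<in> span (T \<union> unit_vec ` rep ` V)"
        using rep(2)[OF v(1)] span_mono[of T "T \<union> unit_vec ` rep ` V"] unfolding sim_def by blast
      moreover have "unit_vec (rep v) \<in> span (T \<union> unit_vec ` rep ` V)"
        using v by (intro span_base) auto
      ultimately have "(unit_vec v - unit_vec (rep v)) + unit_vec (rep v) \<in> span (T \<union> unit_vec ` rep ` V)"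
        by (rule span_add)
      then show "x \<in> span (T \<union> unit_vec ` rep ` V)"
        using v by simp
    qed
    have "finite (T \<union> unit_vec ` rep ` V)"
      using finT V by simp
    then have "card (unit_vec ` V) \<le> card (T \<union> unit_vec ` rep ` V)"
      using independent_span_bound[OF _ independent_unit_vecs sub] by simp
    also have "\<dots> \<le> card T + card (unit_vec ` rep ` V)"
      by (rule card_Un_le)
    also have "\<dots> \<le> card T + card (rep ` V)"
      using V by (simp add: card_image_le)
    finally have "card V \<le> dim (edge_vec ` R) + card (rep ` V)"
      using T(3) by (simp add: card_image inj_on_subset[OF inj_unit_vec])
    then show "(\<Sum>r\<in>rep ` V. card (cls r) - 1) \<le> dim (edge_vec ` R)"
      using sum by linarith
  qed
  finally show ?thesis .
qed

text \<open>The sufficiency half of Nash-Williams's arboricity theorem: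
  \<open>edge_vecs_dense\<close> turns the edge bound on vertex sets into the rank bound that
  \<open>independent_cover\<close> asks for.\<close>

theorem forest_cover:
  assumes V: "finite V" and E: "\<And>e. e \<in> E \<Longrightarrow> e \<subseteq> V \<and> card e = 2"
    and dense: "\<And>C. C \<subseteq> V \<Longrightarrow> C \<noteq> {} \<Longrightarrow> card {e \<in> E. e \<subseteq> C} \<le> k * (card C - 1)"
  shows "\<exists>S. (\<forall>i<k. S i \<subseteq> E \<and> forest (S i)) \<and> (\<Union>i<k. S i) = E"
proof -
  have finE: "finite E"
    using V E by (meson PowI finite_Pow_iff finite_subset subsetI)
  have inj: "inj_on edge_vec E"
    using E by (intro inj_edge_vec) auto
  have "\<exists>F. (\<forall>i<k. F i \<subseteq> edge_vec ` E \<and> independent (F i)) \<and> (\<Union>i<k. F i) = edge_vec ` E"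
  proof (rule independent_cover)
    fix R' assume "R' \<subseteq> edge_vec ` E"
    then obtain R where R: "R \<subseteq> E" "R' = edge_vec ` R"
      by (meson subset_image_iff)
    then show "card R' \<le> k * dim R'"
      using edge_vecs_dense[OF V E dense R(1)] card_image[OF inj_on_subset[OF inj R(1)]] by simp
  qed (use finE in simp)
  then obtain F where F: "\<And>i. i < k \<Longrightarrow> F i \<subseteq> edge_vec ` E" "\<And>i. i < k \<Longrightarrow> independent (F i)"
    "(\<Union>i<k. F i) = edge_vec ` E"
    by blast
  define S where "S i = {e \<in> E. edge_vec e \<in> F i}" for i
  have "forest (S i)" if "i < k" for i
  proof (rule independent_edge_vecs_forest)
    have "edge_vec ` S i \<subseteq> F i"
      by (auto simp: S_def)
    then show "independent (edge_vec ` S i)"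
      using F(2)[OF that] independent_mono by blast
  qed (use finE E in \<open>auto simp: S_def\<close>)
  moreover have "(\<Union>i<k. S i) = E"
    using F(3) unfolding S_def by blast
  ultimately show ?thesis
    by (intro exI[of _ S]) (auto simp: S_def)
qed

text \<open>
  Deleting a vertex \<open>x\<close> from \<open>insert x C\<close> destroys one edge for each neighbour of \<open>x\<close> in \<open>C\<close>, while every
  edge inside \<open>C\<close> meets a neighbour of \<open>x\<close>. Hence the ratio of edges to vertices minus one does
  not increase when vertices are deleted.
\<close>

lemma multipartite_dense:
  fixes part :: "'a \<Rightarrow> 'b"
  assumes V: "finite V" and E: "E = {{u, v} | u v. u \<in> V \<and> v \<in> V \<and> part u \<noteq> part v}"
    and total: "card E \<le> k * (card V - 1)"
    and C: "C \<subseteq> V" "C \<noteq> {}"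
  shows "card {e \<in> E. e \<subseteq> C} \<le> k * (card C - 1)"
  using C
proof (induction "card (V - C)" arbitrary: C)
  case 0
  then have "C = V"
    using V by auto
  moreover have "{e \<in> E. e \<subseteq> V} = E"
    by (auto simp: E)
  ultimately show ?case
    using total by simp
next
  case (Suc n)
  have "V - C \<noteq> {}"
    using Suc.hyps(2) by force
  then obtain x where x: "x \<in> V" "x \<notin> C" by blast
  have finC: "finite C"
    using Suc.prems V finite_subset by blast
  have "V - insert x C = V - C - {x}"
    by auto
  moreover have "card (V - C - {x}) = n"
    using Suc.hyps(2) x V by simp
  ultimately have "n = card (V - insert x C)"
    by simp
  then have IH: "card {e \<in> E. e \<subseteq> insert x C} \<le> k * card C"
    using Suc.hyps(1)[of "insert x C"] Suc.prems x finC by simp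
  have finE: "finite E"
    using V by (rule_tac finite_subset[of E "Pow V"]) (auto simp: E)
  define B where "B = {y \<in> C. part y \<noteq> part x}"
  have finB: "finite B"
    using finC by (simp add: B_def)
  have "card {e \<in> E. e \<subseteq> C} + card B \<le> card {e \<in> E. e \<subseteq> insert x C}"
  proof -
    have "inj_on (\<lambda>y. {x, y}) B"
      by (auto simp: inj_on_def doubleton_eq_iff)
    then have "card {e \<in> E. e \<subseteq> C} + card B = card {e \<in> E. e \<subseteq> C} + card ((\<lambda>y. {x, y}) ` B)"
      by (simp add: card_image)
    also have "\<dots> = card ({e \<in> E. e \<subseteq> C} \<union> (\<lambda>y. {x, y}) ` B)"
      using x finE finB by (intro card_Un_disjoint[symmetric]) auto
    also have "\<dots> \<le> card {e \<in> E. e \<subseteq> insert x C}"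
    proof (rule card_mono)
      have "{x, y} \<in> E" if "y \<in> B" for y
      proof -
        have "y \<in> V" "part x \<noteq> part y"
          using that Suc.prems by (auto simp: B_def)
        then show ?thesis
          unfolding E using x(1) by blast
      qed
      then show "{e \<in> E. e \<subseteq> C} \<union> (\<lambda>y. {x, y}) ` B \<subseteq> {e \<in> E. e \<subseteq> insert x C}"
        by (auto simp: B_def)
    qed (use finE in simp)
    finally show ?thesis .
  qed
  then have up: "card {e \<in> E. e \<subseteq> C} + card B \<le> k * card C"
    using IH by linarith
  have "{e \<in> E. e \<subseteq> C} \<subseteq> (\<Union>y\<in>B. (\<lambda>z. {y, z}) ` (C - {y}))"
  proof
    fix e assume "e \<in> {e \<in> E. e \<subseteq> C}"
    then obtain u v where uv: "e = {u, v}" "part u \<noteq> part v" "u \<in> C" "v \<in> C"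
      unfolding E by auto
    moreover from uv(2) have "part u \<noteq> part x \<or> part v \<noteq> part x"
      by auto
    ultimately consider "u \<in> B" | "v \<in> B"
      unfolding B_def by blast
    then show "e \<in> (\<Union>y\<in>B. (\<lambda>z. {y, z}) ` (C - {y}))"
    proof cases
      case 1
      then show ?thesis using uv by blast
    next
      case 2
      moreover have "e = {v, u}" "u \<in> C - {v}"
        using uv by auto
      ultimately show ?thesis by blast
    qed
  qed
  then have "card {e \<in> E. e \<subseteq> C} \<le> card (\<Union>y\<in>B. (\<lambda>z. {y, z}) ` (C - {y}))"
    using finB finC by (intro card_mono) auto
  also have "\<dots> \<le> (\<Sum>y\<in>B. card ((\<lambda>z. {y, z}) ` (C - {y})))"
    using finB by (rule card_UN_le)
  also have "\<dots> \<le> (\<Sum>y\<in>B. card C - 1)"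
  proof (rule sum_mono)
    fix y assume "y \<in> B"
    then have "card (C - {y}) = card C - 1"
      using finC by (auto simp: B_def)
    then show "card ((\<lambda>z. {y, z}) ` (C - {y})) \<le> card C - 1"
      using card_image_le[of "C - {y}" "\<lambda>z. {y, z}"] finC by simp
  qed
  also have "\<dots> = card B * (card C - 1)"
    by simp
  finally have bound: "card {e \<in> E. e \<subseteq> C} \<le> card B * (card C - 1)" .
  have "card C \<noteq> 0"
    using Suc.prems finC by simp
  then obtain c where c: "card C = Suc c"
    by (cases "card C") auto
  show ?case
  \<comment> \<open>If \<open>x\<close> has at most \<open>k\<close> neighbours in \<open>C\<close>,
    the edges are few because each meets a neighbour. Otherwise deleting \<open>x\<close> removes
    more than \<open>k\<close> edges, while the allowance drops by \<open>k\<close> only.\<close>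
  proof (cases "card B \<le> k")
    case True
    then show ?thesis
      using bound mult_le_mono1[OF True, of "card C - 1"] by linarith
  next
    case False
    then show ?thesis
      using up by (simp add: c)
  qed
qed

section \<open>Planarity of doubled forests\<close>

definition parabola :: "real \<Rightarrow> real \<Rightarrow> real \<Rightarrow> real \<Rightarrow> complex" where
  "parabola s x y \<tau> = Complex (x + \<tau> * (y - x)) (s * (\<tau> * (y - x)) * ((1 - \<tau>) * (y - x)))"

lemma arc_parabola:
  assumes "x < y"
  shows "arc (parabola s x y)"
proof -
  have "continuous_on {0..1} (parabola s x y)"
    unfolding parabola_def Complex_eq by (intro continuous_intros)
  moreover have "inj_on (parabola s x y) {0..1}"
    using assms by (auto simp: inj_on_def parabola_def)
  ultimately show ?thesis
    by (simp add: arc_def path_def)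
qed

lemma pathstart_parabola: "pathstart (parabola s x y) = complex_of_real x"
  by (simp add: pathstart_def parabola_def complex_of_real_def)

lemma pathfinish_parabola: "pathfinish (parabola s x y) = complex_of_real y"
  by (simp add: pathfinish_def parabola_def complex_of_real_def)

lemma path_image_parabola:
  assumes "x < y"
  shows "path_image (parabola s x y) =
    {z. x \<le> Re z \<and> Re z \<le> y \<and> Im z = s * ((Re z - x) * (y - Re z))}"
proof
  show "path_image (parabola s x y) \<subseteq>
    {z. x \<le> Re z \<and> Re z \<le> y \<and> Im z = s * ((Re z - x) * (y - Re z))}"
  proof
    fix z assume "z \<in> path_image (parabola s x y)"
    then obtain \<tau> where \<tau>: "0 \<le> \<tau>" "\<tau> \<le> 1" "z = parabola s x y \<tau>"
      by (auto simp: path_image_def)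
    have "0 \<le> \<tau> * (y - x)" "0 \<le> (1 - \<tau>) * (y - x)"
      using \<tau> assms by auto
    moreover have "y - (x + \<tau> * (y - x)) = (1 - \<tau>) * (y - x)"
      by (simp add: algebra_simps)
    ultimately show "z \<in> {z. x \<le> Re z \<and> Re z \<le> y \<and> Im z = s * ((Re z - x) * (y - Re z))}"
      using \<tau>(3) by (simp add: parabola_def)
  qed
next
  show "{z. x \<le> Re z \<and> Re z \<le> y \<and> Im z = s * ((Re z - x) * (y - Re z))} \<subseteq> path_image (parabola s x y)"
  proof
    fix z assume z: "z \<in> {z. x \<le> Re z \<and> Re z \<le> y \<and> Im z = s * ((Re z - x) * (y - Re z))}"
    define \<tau> where "\<tau> = (Re z - x) / (y - x)"
    have \<tau>: "\<tau> * (y - x) = Re z - x" "(1 - \<tau>) * (y - x) = y - Re z"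
      using assms by (auto simp: \<tau>_def field_simps)
    have "0 \<le> \<tau>" "\<tau> \<le> 1"
      using z assms by (auto simp: \<tau>_def)
    moreover have "z = parabola s x y \<tau>"
      unfolding parabola_def \<tau> using z by (simp add: complex_eq_iff)
    ultimately show "z \<in> path_image (parabola s x y)"
      by (auto simp: path_image_def)
  qed
qed

text \<open>The height at \<open>t\<close> is the product of the distances to the two ends, so it
  grows with the interval. At a common point off the axis the signs agree and the intervals overlap;
  as they do not interleave, one contains the other, and its parabola is strictly higher
  there.\<close>

lemma parabolas_Int_real:
  assumes xy: "x < y" "x' < y'" and s: "\<bar>s\<bar> = 1" "\<bar>s'\<bar> = 1" and ne: "(x, y) \<noteq> (x', y')"
    and nc: "s = s' \<Longrightarrow> \<not> (x < x' \<and> x' < y \<and> y < y') \<and> \<not> (x' < x \<and> x < y' \<and> y' < y)"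
    and z: "z \<in> path_image (parabola s x y)" "z \<in> path_image (parabola s' x' y')"
  shows "Im z = 0 \<and> Re z \<in> {x, y} \<inter> {x', y'}"
proof -
  let ?t = "Re z"
  have t: "x \<le> ?t" "?t \<le> y" "x' \<le> ?t" "?t \<le> y'"
    and im: "Im z = s * ((?t - x) * (y - ?t))" "Im z = s' * ((?t - x') * (y' - ?t))"
    using z xy by (auto simp: path_image_parabola)
  have nn: "0 \<le> (?t - x) * (y - ?t)" "0 \<le> (?t - x') * (y' - ?t)"
    using t by auto
  have "(?t - x) * (y - ?t) = 0"
  proof (rule ccontr)
    assume nz: "(?t - x) * (y - ?t) \<noteq> 0"
    have "\<bar>Im z\<bar> = (?t - x) * (y - ?t)" "\<bar>Im z\<bar> = (?t - x') * (y' - ?t)"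
      using im s nn by (metis abs_mult abs_of_nonneg mult_1)+
    then have eq: "(?t - x) * (y - ?t) = (?t - x') * (y' - ?t)"
      by simp
    then have "s = s'"
      using im nz by auto
    have strict: "0 < ?t - x" "0 < y - ?t" "0 < ?t - x'" "0 < y' - ?t"
      using nz eq t by (auto simp: less_le)
    consider "x < x'" | "x' < x" | "x = x'" by linarith
    then show False
    proof cases
      case 1
      then have "y' \<le> y"
        using nc[OF \<open>s = s'\<close>] strict by linarith
      then have "(?t - x') * (y' - ?t) < (?t - x) * (y - ?t)"
        using 1 strict by (intro mult_less_le_imp_less) auto
      then show ?thesis using eq by simp
    next
      case 2
      then have "y \<le> y'"
        using nc[OF \<open>s = s'\<close>] strict by linarith
      then have "(?t - x) * (y - ?t) < (?t - x') * (y' - ?t)"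
        using 2 strict by (intro mult_less_le_imp_less) auto
      then show ?thesis using eq by simp
    next
      case 3
      then have "y = y'"
        using eq strict by auto
      then show ?thesis using 3 ne by simp
    qed
  qed
  moreover from this have "Im z = 0" "(?t - x') * (y' - ?t) = 0"
    using im s by auto
  ultimately show ?thesis by auto
qed

text \<open>A two-page book embedding: the real axis is the spine, the two half-planes are the
  pages, and \<open>up\<close> assigns the page. Since the two edges can be exchanged in
  \<open>nc\<close>, it excludes interleaving in either direction.\<close>

lemma planar_two_page_book:
  fixes pos :: "'a \<Rightarrow> real" and up :: "'a set \<Rightarrow> bool"
  assumes G: "simple_graph G" and inj: "inj_on pos (verts G)"
    and nc: "\<And>a b c d. {a, b} \<in> edges G \<Longrightarrow> {c, d} \<in> edges G \<Longrightarrow> up {a, b} = up {c, d} \<Longrightarrow>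
      \<not> (pos a < pos c \<and> pos c < pos b \<and> pos b < pos d)"
  shows "planar G"
proof -
  define p where "p v = complex_of_real (pos v)" for v
  define sg where "sg e = (if up e then 1 else - 1 :: real)" for e
  define \<gamma> where "\<gamma> e = parabola (sg e) (Min (pos ` e)) (Max (pos ` e))" for e
  have edge: "\<exists>a b. e = {a, b} \<and> a \<in> verts G \<and> b \<in> verts G \<and> pos a < pos b \<and> \<gamma> e = parabola (sg e) (pos a) (pos b)"
    if e: "e \<in> edges G" for e
  proof -
    obtain a b where ab: "e = {a, b}" "a \<noteq> b" "a \<in> verts G" "b \<in> verts G"
      using G e unfolding simple_graph_def by (metis card_2_iff insert_subset)
    then have "pos a \<noteq> pos b"
      using inj by (auto simp: inj_on_def)
    then show ?thesis
    proof (cases "pos a < pos b")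
      case True
      then show ?thesis using ab by (auto simp: \<gamma>_def)
    next
      case False
      then have "pos b < pos a" using \<open>pos a \<noteq> pos b\<close> by simp
      then show ?thesis using ab by (intro exI[of _ b] exI[of _ a]) (auto simp: \<gamma>_def)
    qed
  qed
  have "planar_drawing G p \<gamma>"
    unfolding planar_drawing_def
  proof (intro conjI ballI impI)
    show "inj_on p (verts G)"
      using inj by (auto simp: inj_on_def p_def)
  next
    fix e assume "e \<in> edges G"
    then obtain a b where ab: "e = {a, b}" "a \<in> verts G" "b \<in> verts G" "pos a < pos b" "\<gamma> e = parabola (sg e) (pos a) (pos b)"
      using edge by blast
    show "arc (\<gamma> e)"
      using ab by (simp add: arc_parabola)
    show "{pathstart (\<gamma> e), pathfinish (\<gamma> e)} = p ` e"
      using ab by (simp add: pathstart_parabola pathfinish_parabola p_def)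
    show "path_image (\<gamma> e) \<inter> p ` verts G = p ` e"
    proof
      show "p ` e \<subseteq> path_image (\<gamma> e) \<inter> p ` verts G"
        using ab by (auto simp: path_image_parabola p_def)
      show "path_image (\<gamma> e) \<inter> p ` verts G \<subseteq> p ` e"
      proof
        fix z assume "z \<in> path_image (\<gamma> e) \<inter> p ` verts G"
        then obtain v where v: "v \<in> verts G" "z = p v" "0 = sg e * ((pos v - pos a) * (pos b - pos v))"
          using ab by (auto simp: path_image_parabola p_def)
        then have "pos v = pos a \<or> pos v = pos b"
          by (auto simp: sg_def split: if_splits)
        then show "z \<in> p ` e"
          using v ab by (auto simp: p_def)
      qed
    qed
  next
    fix e f assume e: "e \<in> edges G" and f: "f \<in> edges G" and "e \<noteq> f"
    obtain a b where ab: "e = {a, b}" "a \<in> verts G" "b \<in> verts G" "pos a < pos b" "\<gamma> e = parabola (sg e) (pos a) (pos b)"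
      using edge[OF e] by blast
    obtain c d where cd: "f = {c, d}" "c \<in> verts G" "d \<in> verts G" "pos c < pos d" "\<gamma> f = parabola (sg f) (pos c) (pos d)"
      using edge[OF f] by blast
    show "path_image (\<gamma> e) \<inter> path_image (\<gamma> f) = p ` (e \<inter> f)"
    proof
      show "p ` (e \<inter> f) \<subseteq> path_image (\<gamma> e) \<inter> path_image (\<gamma> f)"
        using ab cd by (auto simp: path_image_parabola p_def)
      show "path_image (\<gamma> e) \<inter> path_image (\<gamma> f) \<subseteq> p ` (e \<inter> f)"
      proof
        fix z assume z: "z \<in> path_image (\<gamma> e) \<inter> path_image (\<gamma> f)"
        have "Im z = 0 \<and> Re z \<in> {pos a, pos b} \<inter> {pos c, pos d}"
        proof (rule parabolas_Int_real[OF ab(4) cd(4)])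
          show "\<bar>sg e\<bar> = 1" "\<bar>sg f\<bar> = 1"
            by (auto simp: sg_def)
          show "(pos a, pos b) \<noteq> (pos c, pos d)"
            using \<open>e \<noteq> f\<close> ab cd inj by (auto simp: inj_on_def)
          show "\<not> (pos a < pos c \<and> pos c < pos b \<and> pos b < pos d) \<and> \<not> (pos c < pos a \<and> pos a < pos d \<and> pos d < pos b)"
            if "sg e = sg f"
          proof -
            have "up {a, b} = up {c, d}"
              using that ab(1) cd(1) by (auto simp: sg_def split: if_splits)
            then show ?thesis
              using nc[of a b c d] nc[of c d a b] e f ab(1) cd(1) by auto
          qed
          show "z \<in> path_image (parabola (sg e) (pos a) (pos b))" "z \<in> path_image (parabola (sg f) (pos c) (pos d))"
            using z ab cd by auto
        qed
        then have "Im z = 0" "Re z \<in> pos ` e" "Re z \<in> pos ` f"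
          using ab(1) cd(1) by auto
        moreover have "e \<subseteq> verts G" "f \<subseteq> verts G"
          using ab cd by auto
        ultimately obtain v w where vw: "v \<in> e" "w \<in> f" "pos v = Re z" "pos w = Re z" "v \<in> verts G" "w \<in> verts G" "Im z = 0"
          by (metis imageE subsetD)
        then have "v = w"
          using inj by (metis inj_onD)
        moreover have "z = p v"
          using vw by (simp add: p_def complex_eq_iff)
        ultimately show "z \<in> p ` (e \<inter> f)"
          using vw by blast
      qed
    qed
  qed
  then show ?thesis
    unfolding planar_def by blast
qed

section \<open>Leaves of forests and nested intervals\<close>

lemma forest_subset: "forest S \<Longrightarrow> T \<subseteq> S \<Longrightarrow> forest T"
  unfolding forest_def by (meson finite_subset order_trans subsetD)

text \<open>The degrees sum to twice the number of edges, which is less than twice the number of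
  vertices covered. So some covered vertex has degree below two, that is, one.\<close>

lemma forest_leaf:
  assumes S: "forest S" "S \<noteq> {}"
  obtains v c where "{v, c} \<in> S" "v \<noteq> c" "\<And>e. e \<in> S \<Longrightarrow> c \<in> e \<Longrightarrow> e = {v, c}"
proof -
  have fin: "finite S" and two: "\<And>e. e \<in> S \<Longrightarrow> card e = 2"
    using S by (auto simp: forest_def)
  have finU: "finite (\<Union>S)"
    using fin two by (metis card.infinite finite_Union zero_neq_numeral)
  have "(\<Sum>c\<in>\<Union>S. card {e \<in> S. c \<in> e}) = (\<Sum>c\<in>\<Union>S. \<Sum>e\<in>S. if c \<in> e then 1 else 0)"
    by (intro sum.cong) (auto simp: sum.If_cases fin Int_def)
  also have "\<dots> = (\<Sum>e\<in>S. \<Sum>c\<in>\<Union>S. if c \<in> e then 1 else 0)"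
    by (rule sum.swap)
  also have "\<dots> = (\<Sum>e\<in>S. card e)"
    by (intro sum.cong) (auto simp: sum.If_cases finU intro!: arg_cong[where f = card])
  also have "\<dots> = 2 * card S"
    using two by simp
  also have "\<dots> < (\<Sum>c\<in>\<Union>S. 2)"
    using S by (simp add: forest_def)
  finally have "\<exists>c\<in>\<Union>S. card {e \<in> S. c \<in> e} < 2"
    by (meson not_less sum_mono)
  then obtain c e where c: "c \<in> e" "e \<in> S" "card {e \<in> S. c \<in> e} < 2"
    by auto
  then have "card {e \<in> S. c \<in> e} \<le> Suc 0" by simp
  then have uniq: "f = e" if "f \<in> S" "c \<in> f" for f
    using that c fin card_le_Suc0_iff_eq[of "{e \<in> S. c \<in> e}"] by auto
  obtain a b where "e = {a, b}" "a \<noteq> b"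
    using two[OF c(2)] by (auto simp: card_2_iff)
  then obtain v where "e = {v, c}" "v \<noteq> c"
    using c(1) by auto
  then show thesis
    using that uniq c(2) by blast
qed

text \<open>
  A layout gives each vertex \<open>v\<close> an interval \<open>[l v, r v]\<close>; a pair \<open>(v, c)\<close> in \<open>D\<close> says that
  \<open>v\<close> is the parent of \<open>c\<close>, whose interval then lies directly inside that of \<open>v\<close>.
\<close>

definition laminar_layout :: "'a set \<Rightarrow> ('a \<times> 'a) set \<Rightarrow> ('a \<Rightarrow> real) \<Rightarrow> ('a \<Rightarrow> real) \<Rightarrow> bool" where
  "laminar_layout A D l r \<longleftrightarrow> D \<subseteq> A \<times> A \<and>
     (\<forall>v\<in>A. l v < r v) \<and>
     (\<forall>v\<in>A. \<forall>w\<in>A. v \<noteq> w \<longrightarrow> l v \<noteq> l w \<and> r v \<noteq> r w \<and> l v \<noteq> r w) \<and>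
     (\<forall>v\<in>A. \<forall>w\<in>A. \<not> (l v < l w \<and> l w < r v \<and> r v < r w)) \<and>
     (\<forall>(v, c)\<in>D. l v < l c \<and> r c < r v \<and> (\<forall>w\<in>A. \<not> (l v < l w \<and> l w < l c \<and> r c < r w)))"

lemma laminar_layoutD:
  assumes "laminar_layout A D l r"
  shows "D \<subseteq> A \<times> A" "\<And>v. v \<in> A \<Longrightarrow> l v < r v"
    and "\<And>v w. v \<in> A \<Longrightarrow> w \<in> A \<Longrightarrow> v \<noteq> w \<Longrightarrow> l v \<noteq> l w \<and> r v \<noteq> r w \<and> l v \<noteq> r w"
    and "\<And>v w. v \<in> A \<Longrightarrow> w \<in> A \<Longrightarrow> \<not> (l v < l w \<and> l w < r v \<and> r v < r w)"
    and "\<And>v c. (v, c) \<in> D \<Longrightarrow> l v < l c \<and> r c < r v"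
    and "\<And>v c w. (v, c) \<in> D \<Longrightarrow> w \<in> A \<Longrightarrow> \<not> (l v < l w \<and> l w < l c \<and> r c < r w)"
proof -
  note * = assms[unfolded laminar_layout_def]
  show "D \<subseteq> A \<times> A" "\<And>v. v \<in> A \<Longrightarrow> l v < r v"
    using * by auto
  show "l v \<noteq> l w \<and> r v \<noteq> r w \<and> l v \<noteq> r w" if "v \<in> A" "w \<in> A" "v \<noteq> w" for v w
    using * that by simp
  show "\<not> (l v < l w \<and> l w < r v \<and> r v < r w)" if "v \<in> A" "w \<in> A" for v w
    using * that by simp
  have D: "\<forall>(v, c)\<in>D. l v < l c \<and> r c < r v \<and> (\<forall>w\<in>A. \<not> (l v < l w \<and> l w < l c \<and> r c < r w))"
    using * by (elim conjE)
  show "l v < l c \<and> r c < r v" if "(v, c) \<in> D" for v c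
    using bspec[OF D that] by simp
  show "\<not> (l v < l w \<and> l w < l c \<and> r c < r w)" if "(v, c) \<in> D" "w \<in> A" for v c w
    using bspec[OF D that(1)] that(2) by simp
qed

text \<open>Remove a leaf \<open>c\<close> with neighbour \<open>v\<close>, lay out the rest, and
  then move the interval of \<open>c\<close> to just behind \<open>l v\<close>, before any other
  endpoint. Nothing fits between \<open>v\<close> and \<open>c\<close>, and no other relation is
  disturbed, since \<open>c\<close> is isolated in the rest. The set \<open>A\<close> stays fixed
  while edges are removed.\<close>

lemma forest_laminar_layout:
  assumes "forest S" "finite A" "\<Union>S \<subseteq> A"
  shows "\<exists>D l r. laminar_layout A D l r \<and> (\<lambda>(v, c). {v, c}) ` D = S"
  using assms
proof (induction "card S" arbitrary: S)
  case 0
  then have "S = {}"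
    by (auto simp: forest_def)
  obtain f :: "'a \<Rightarrow> nat" where f: "inj_on f A"
    using \<open>finite A\<close> finite_imp_inj_to_nat_seg by blast
  \<comment> \<open>Without edges, disjoint intervals of length one half that start at distinct
    integers will do.\<close>
  have "laminar_layout A {} (\<lambda>v. real (f v)) (\<lambda>v. real (f v) + 1 / 2)"
    unfolding laminar_layout_def
  proof (intro conjI ballI impI)
    fix v w assume "v \<in> A" "w \<in> A" "v \<noteq> w"
    then have "f v \<noteq> f w" using f by (auto simp: inj_on_def)
    then show "real (f v) \<noteq> real (f w)" "real (f v) + 1 / 2 \<noteq> real (f w) + 1 / 2" by auto
    show "real (f v) \<noteq> real (f w) + 1 / 2"
    proof
      assume "real (f v) = real (f w) + 1 / 2"
      then have "real (2 * f v) = real (2 * f w + 1)" by simp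
      then have "2 * f v = 2 * f w + 1" by linarith
      then show False by presburger
    qed
  next
    fix v w
    show "\<not> (real (f v) < real (f w) \<and> real (f w) < real (f v) + 1 / 2 \<and> real (f v) + 1 / 2 < real (f w) + 1 / 2)"
      by (cases "f v < f w") auto
  qed auto
  then show ?case
    using \<open>S = {}\<close> by blast
next
  case (Suc n)
  then have "S \<noteq> {}" by auto
  obtain v c where vc: "{v, c} \<in> S" "v \<noteq> c" "\<And>e. e \<in> S \<Longrightarrow> c \<in> e \<Longrightarrow> e = {v, c}"
    using forest_leaf[OF Suc.prems(1) \<open>S \<noteq> {}\<close>] by blast
  let ?S = "S - {{v, c}}"
  have finS: "finite S"
    using Suc.prems(1) by (simp add: forest_def)
  have "n = card ?S"
    using Suc.hyps(2) vc(1) finS by simp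
  then obtain D l r where lay: "laminar_layout A D l r" and D: "(\<lambda>(v, c). {v, c}) ` D = ?S"
  proof -
    assume *: "\<And>D l r. laminar_layout A D l r \<Longrightarrow> (\<lambda>(v, c). {v, c}) ` D = ?S \<Longrightarrow> thesis"
    have "\<exists>D l r. laminar_layout A D l r \<and> (\<lambda>(v, c). {v, c}) ` D = ?S"
      using \<open>n = card ?S\<close> Suc.prems forest_subset[OF Suc.prems(1)] by (intro Suc.hyps(1)) auto
    then show thesis
      by (elim exE conjE) (rule *)
  qed
  have vcA: "v \<in> A" "c \<in> A"
    using vc(1) Suc.prems(3) by auto
  note DA = laminar_layoutD(1)[OF lay] and lr = laminar_layoutD(2)[OF lay] and dist = laminar_layoutD(3)[OF lay]
    and lam = laminar_layoutD(4)[OF lay] and par = laminar_layoutD(5)[OF lay] and dir = laminar_layoutD(6)[OF lay]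
  have cD: "u \<noteq> c" "d \<noteq> c" if "(u, d) \<in> D" for u d
  proof -
    have "{u, d} \<in> ?S"
      using imageI[OF that, of "\<lambda>(v, c). {v, c}"] unfolding D by simp
    then show "u \<noteq> c" "d \<noteq> c"
      using vc(3)[of "{u, d}"] by auto
  qed
  \<comment> \<open>The endpoints to the right of \<open>l v\<close>. The old interval of
    \<open>c\<close> is about to be overwritten and does not count; \<open>r v\<close> keeps the set
    nonempty.\<close>
  define Z where "Z = {z \<in> l ` (A - {c}) \<union> r ` (A - {c}). l v < z}"
  have finZ: "finite Z"
    using \<open>finite A\<close> by (simp add: Z_def)
  have rvZ: "r v \<in> Z"
    using vcA vc(2) lr by (auto simp: Z_def)
  define g where "g = Min Z"
  have "g \<in> Z" "g \<le> r v"
    using finZ rvZ by (auto simp: g_def intro: Min_in)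
  then have g: "l v < g" "g \<le> r v"
    by (auto simp: Z_def)
  have gap: "l w \<le> l v \<or> g \<le> l w" "r w \<le> l v \<or> g \<le> r w" if "w \<in> A" "w \<noteq> c" for w
  proof -
    have "l w \<in> Z" if "l v < l w"
      using that \<open>w \<in> A\<close> \<open>w \<noteq> c\<close> by (auto simp: Z_def)
    moreover have "r w \<in> Z" if "l v < r w"
      using that \<open>w \<in> A\<close> \<open>w \<noteq> c\<close> by (auto simp: Z_def)
    ultimately show "l w \<le> l v \<or> g \<le> l w" "r w \<le> l v \<or> g \<le> r w"
      unfolding g_def using Min_le[OF finZ] by (meson not_le)+
  qed
  define x where "x = l v + (g - l v) / 3"
  define y where "y = l v + 2 * (g - l v) / 3"
  have xy: "l v < x" "x < y" "y < g"
    using g by (auto simp: x_def y_def field_simps)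
  let ?l = "l(c := x)" and ?r = "r(c := y)"
  have "laminar_layout A (insert (v, c) D) ?l ?r"
    unfolding laminar_layout_def
  proof (intro conjI ballI impI)
    show "insert (v, c) D \<subseteq> A \<times> A"
      using DA vcA by auto
  next
    fix w assume "w \<in> A"
    then show "?l w < ?r w"
      using lr xy by auto
  next
    fix u w assume uw: "u \<in> A" "w \<in> A" "u \<noteq> w"
    show "?l u \<noteq> ?l w" "?r u \<noteq> ?r w" "?l u \<noteq> ?r w"
      using dist[OF uw] gap[OF uw(1)] gap[OF uw(2)] uw(3) xy by auto
  next
    fix u w assume uw: "u \<in> A" "w \<in> A"
    show "\<not> (?l u < ?l w \<and> ?l w < ?r u \<and> ?r u < ?r w)"
      using lam[OF uw] gap[OF uw(1)] gap[OF uw(2)] xy by auto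
  next
    fix e assume "e \<in> insert (v, c) D"
    then consider "e = (v, c)" | u d where "e = (u, d)" "(u, d) \<in> D"
      by (cases e) auto
    then show "case e of (v, d) \<Rightarrow> ?l v < ?l d \<and> ?r d < ?r v \<and> (\<forall>w\<in>A. \<not> (?l v < ?l w \<and> ?l w < ?l d \<and> ?r d < ?r w))"
    proof cases
      case 1
      have "\<not> (l v < ?l w \<and> ?l w < x \<and> y < ?r w)" if "w \<in> A" for w
        using gap[OF that] xy by auto
      then show ?thesis
        using 1 xy g vc(2) by auto
    next
      case 2
      have "u \<in> A" "d \<in> A"
        using 2 DA by auto
      have "\<not> (l u < ?l w \<and> ?l w < l d \<and> r d < ?r w)" if "w \<in> A" for w
        using dir[OF 2(2) that] gap[of d] lr[of d] \<open>d \<in> A\<close> cD[OF 2(2)] xy by auto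
      then show ?thesis
        using 2 par[OF 2(2)] cD[OF 2(2)] by auto
    qed
  qed
  moreover have "(\<lambda>(v, c). {v, c}) ` insert (v, c) D = S"
    using D vc(1) by auto
  ultimately show ?case by blast
qed

text \<open>Otherwise the end \<open>x\<close> of \<open>c\<close> would lie in the interval of
  \<open>w\<close>. By laminarity \<open>c\<close> would lie inside \<open>w\<close>, and
  \<open>w\<close> begins after \<open>v\<close>, so \<open>w\<close> would come between
  \<open>v\<close> and its child \<open>c\<close>.\<close>

lemma laminar_layout_up:
  assumes lay: "laminar_layout A D l r" and D: "(v, c) \<in> D" "(w, d) \<in> D"
    and x: "x \<in> {l c, r c}" and y: "y \<in> {l d, r d}"
  shows "\<not> (l v < l w \<and> l w < x \<and> x < y)"
proof
  assume asm: "l v < l w \<and> l w < x \<and> x < y"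
  have A: "v \<in> A" "c \<in> A" "w \<in> A" "d \<in> A"
    using lay D by (auto simp: laminar_layout_def)
  note lr = laminar_layoutD(2)[OF lay] and dist = laminar_layoutD(3)[OF lay] and lam = laminar_layoutD(4)[OF lay]
    and par = laminar_layoutD(5)[OF lay] and dir = laminar_layoutD(6)[OF lay]
  have "x < r w"
    using asm y par[OF D(2)] lr[OF A(4)] by auto
  show False
  proof (cases "w = c")
    case True
    then show ?thesis
      using asm x \<open>x < r w\<close> by auto
  next
    case False
    then show ?thesis
      using asm x \<open>x < r w\<close> dist[OF A(3) A(2)] dist[OF A(2) A(3)] lam[OF A(2) A(3)] lam[OF A(3) A(2)] dir[OF D(1) A(3)] lr[OF A(2)]
      by auto
  qed
qed

text \<open>Otherwise \<open>v\<close> would lie inside \<open>w\<close> and the end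
  \<open>y\<close> of \<open>d\<close> in the interval of \<open>v\<close>, so \<open>v\<close>
  would come between \<open>w\<close> and its child \<open>d\<close>.\<close>

lemma laminar_layout_down:
  assumes lay: "laminar_layout A D l r" and D: "(v, c) \<in> D" "(w, d) \<in> D"
    and x: "x \<in> {l c, r c}" and y: "y \<in> {l d, r d}"
  shows "\<not> (x < y \<and> y < r v \<and> r v < r w)"
proof
  assume asm: "x < y \<and> y < r v \<and> r v < r w"
  have A: "v \<in> A" "c \<in> A" "w \<in> A" "d \<in> A"
    using lay D by (auto simp: laminar_layout_def)
  note lr = laminar_layoutD(2)[OF lay] and dist = laminar_layoutD(3)[OF lay] and lam = laminar_layoutD(4)[OF lay]
    and par = laminar_layoutD(5)[OF lay] and dir = laminar_layoutD(6)[OF lay]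
  have "l v < y"
    using asm x par[OF D(1)] lr[OF A(2)] by auto
  have "v \<noteq> w"
    using asm by auto
  have "l w < y"
    using y par[OF D(2)] lr[OF A(4)] by auto
  then have "l w < l v"
    using lam[OF A(1) A(3)] asm dist[OF A(1) A(3) \<open>v \<noteq> w\<close>] by auto
  show False
  proof (cases "d = v")
    case True
    then show ?thesis
      using asm y \<open>l v < y\<close> by auto
  next
    case False
    then show ?thesis
      using asm y \<open>l v < y\<close> \<open>l w < l v\<close> dist[OF A(4) A(1)] dist[OF A(1) A(4)] lam[OF A(4) A(1)] lam[OF A(1) A(4)]
        dir[OF D(2) A(1)] lr[OF A(4)]
      by auto
  qed
qed

text \<open>
  The two copies of \<open>v\<close> are put at the two ends of its interval; the edges from the left copy to
  the copies of the children of \<open>v\<close> are drawn above the axis, those from the right copy below it.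
\<close>

lemma planar_forest_blowup:
  fixes G :: "'b ugraph" and \<pi> :: "'b \<Rightarrow> 'a" and right :: "'b \<Rightarrow> bool"
  assumes S: "forest S" and G: "simple_graph G"
    and inj: "inj_on (\<lambda>u. (\<pi> u, right u)) (verts G)"
    and edges: "\<And>u v. {u, v} \<in> edges G \<Longrightarrow> {\<pi> u, \<pi> v} \<in> S"
  shows "planar G"
proof -
  define A where "A = \<pi> ` verts G \<union> \<Union>S"
  have "finite (\<Union>S)"
    using S by (metis card.infinite finite_Union forest_def zero_neq_numeral)
  then have "finite A"
    using G by (simp add: A_def simple_graph_def)
  then have "\<exists>D l r. laminar_layout A D l r \<and> (\<lambda>(v, c). {v, c}) ` D = S"
    by (intro forest_laminar_layout[OF S]) (auto simp: A_def)
  then obtain D l r where lay: "laminar_layout A D l r" and D: "(\<lambda>(v, c). {v, c}) ` D = S"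
    by (elim exE conjE)
  note DA = laminar_layoutD(1)[OF lay] and lr = laminar_layoutD(2)[OF lay] and dist = laminar_layoutD(3)[OF lay]
    and par = laminar_layoutD(5)[OF lay]
  define pos where "pos u = (if right u then r (\<pi> u) else l (\<pi> u))" for u
  define up where "up e = (\<exists>u v. e = {u, v} \<and> (\<pi> u, \<pi> v) \<in> D \<and> \<not> right u)" for e
  have up_iff: "up {u, v} \<longleftrightarrow> \<not> right u" if "(\<pi> u, \<pi> v) \<in> D" for u v
  proof -
    have "(\<pi> v, \<pi> u) \<notin> D"
      using par[OF that] par[of "\<pi> v" "\<pi> u"] by auto
    then show ?thesis
      using that by (auto simp: up_def doubleton_eq_iff)
  qed
  have pos_ends: "pos u \<in> {l (\<pi> u), r (\<pi> u)}" for u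
    by (simp add: pos_def)
  have orient: "(\<exists>u v. {a, b} = {u, v} \<and> (\<pi> u, \<pi> v) \<in> D)" if "{a, b} \<in> edges G" for a b
  proof -
    have "{\<pi> a, \<pi> b} \<in> (\<lambda>(v, c). {v, c}) ` D"
      using edges[OF that] D by simp
    then obtain v c where "(v, c) \<in> D" "{\<pi> a, \<pi> b} = {v, c}" by auto
    then show ?thesis
      by (metis doubleton_eq_iff)
  qed
  \<comment> \<open>Both copies of a child lie inside the interval of its parent. So an edge drawn
    above starts at the left copy of the parent, and an edge drawn below ends at the right
    copy.\<close>
  have page: "up {a, b} \<and> (\<pi> a, \<pi> b) \<in> D \<and> pos a = l (\<pi> a) \<or> \<not> up {a, b} \<and> (\<pi> b, \<pi> a) \<in> D \<and> pos b = r (\<pi> b)"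
    if e: "{a, b} \<in> edges G" and ab: "pos a < pos b" for a b
  proof -
    obtain u v where uv: "{a, b} = {u, v}" "(\<pi> u, \<pi> v) \<in> D"
      using orient[OF e] by blast
    have "l (\<pi> u) < l (\<pi> v)" "r (\<pi> v) < r (\<pi> u)" "l (\<pi> v) < r (\<pi> v)"
      using par[OF uv(2)] lr[of "\<pi> v"] uv(2) DA by auto
    then have *: "if right u then pos v < pos u else pos u < pos v"
      using pos_ends[of v] by (auto simp: pos_def)
    show ?thesis
    proof (cases "right u")
      case True
      then have "a = v" "b = u"
        using * ab uv(1) by (auto simp: doubleton_eq_iff)
      then show ?thesis
        using True uv up_iff[OF uv(2)] by (auto simp: pos_def)
    next
      case False
      then have "a = u" "b = v"
        using * ab uv(1) by (auto simp: doubleton_eq_iff)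
      then show ?thesis
        using False uv up_iff[OF uv(2)] by (auto simp: pos_def)
    qed
  qed
  show ?thesis
  proof (rule planar_two_page_book[OF G])
    show "inj_on pos (verts G)"
    proof (rule inj_onI)
      fix u v assume uv: "u \<in> verts G" "v \<in> verts G" "pos u = pos v"
      have "\<pi> u \<in> A" "\<pi> v \<in> A"
        using uv by (auto simp: A_def)
      then have "\<pi> u = \<pi> v"
        using uv(3) dist[of "\<pi> u" "\<pi> v"] dist[of "\<pi> v" "\<pi> u"] unfolding pos_def
        by (metis (full_types))
      moreover from this have "right u = right v"
        using uv(3) lr[OF \<open>\<pi> u \<in> A\<close>] unfolding pos_def by (auto split: if_splits)
      ultimately show "u = v"
        using inj uv by (auto simp: inj_on_def)
    qed
  next
    fix a b c d assume e: "{a, b} \<in> edges G" "{c, d} \<in> edges G" and same: "up {a, b} = up {c, d}"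
    show "\<not> (pos a < pos c \<and> pos c < pos b \<and> pos b < pos d)"
    proof
      assume asm: "pos a < pos c \<and> pos c < pos b \<and> pos b < pos d"
      then have "pos a < pos b" "pos c < pos d" by auto
      note pg = page[OF e(1) this(1)] page[OF e(2) this(2)]
      show False
      proof (cases "up {a, b}")
        case True
        then have "(\<pi> a, \<pi> b) \<in> D" "pos a = l (\<pi> a)" "(\<pi> c, \<pi> d) \<in> D" "pos c = l (\<pi> c)"
          using pg same by auto
        then show ?thesis
          using laminar_layout_up[OF lay, of "\<pi> a" "\<pi> b" "\<pi> c" "\<pi> d" "pos b" "pos d"] pos_ends asm by auto
      next
        case False
        then have "(\<pi> b, \<pi> a) \<in> D" "pos b = r (\<pi> b)" "(\<pi> d, \<pi> c) \<in> D" "pos d = r (\<pi> d)"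
          using pg same by auto
        then show ?thesis
          using laminar_layout_down[OF lay, of "\<pi> b" "\<pi> a" "\<pi> d" "\<pi> c" "pos a" "pos c"] pos_ends asm by auto
      qed
    qed
  qed
qed

text \<open>A triangle would project to three different edges of \<open>S\<close> on three vertices,
  against the counting condition for forests.\<close>

lemma girth_forest_blowup:
  assumes S: "forest S" and edges: "\<And>u v. {u, v} \<in> edges G \<Longrightarrow> {\<pi> u, \<pi> v} \<in> S"
  shows "4 \<le> girth G"
  unfolding girth_def
proof (rule INF_greatest)
  fix c assume "c \<in> {c. is_cycle G c}"
  then have c: "is_cycle G c" by simp
  have "length c \<noteq> 3"
  proof
    assume len: "length c = 3"
    have step: "{c ! i, c ! (Suc i mod 3)} \<in> edges G" if "i < 3" for i
      using c that unfolding is_cycle_def len by blast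
    have "{c ! 0, c ! 1} \<in> edges G" "{c ! 1, c ! 2} \<in> edges G" "{c ! 2, c ! 0} \<in> edges G"
      using step[of 0] step[of 1] step[of 2] by (simp_all add: numeral_2_eq_2)
    then have T: "{\<pi> (c ! 0), \<pi> (c ! 1)} \<in> S" "{\<pi> (c ! 1), \<pi> (c ! 2)} \<in> S" "{\<pi> (c ! 2), \<pi> (c ! 0)} \<in> S"
      using edges by blast+
    obtain x y z where xyz: "x = \<pi> (c ! 0)" "y = \<pi> (c ! 1)" "z = \<pi> (c ! 2)" by blast
    have "card {x, y} = 2" "card {y, z} = 2" "card {z, x} = 2"
      using S T unfolding xyz forest_def by blast+
    then have ne: "x \<noteq> y" "y \<noteq> z" "z \<noteq> x"
      by auto
    have "{{x, y}, {y, z}, {z, x}} \<subseteq> S"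
      using T xyz by auto
    then have "card {{x, y}, {y, z}, {z, x}} < card (\<Union>{{x, y}, {y, z}, {z, x}})"
      using S unfolding forest_def by blast
    moreover have "card {{x, y}, {y, z}, {z, x}} = 3"
      using ne by (auto simp: card_insert_if doubleton_eq_iff)
    moreover have "\<Union>{{x, y}, {y, z}, {z, x}} = {x, y, z}" by auto
    moreover have "card {x, y, z} \<le> 3"
      by (auto simp: card_insert_if)
    ultimately show False by simp
  qed
  then have "4 \<le> length c"
    using c unfolding is_cycle_def by linarith
  then show "4 \<le> enat (length c)"
    by (metis enat_ord_simps(1) numeral_eq_enat)
qed

section \<open>Edges of triangle-free plane graphs\<close>

definition adj_star :: "'a set set \<Rightarrow> ('a \<times> 'a) set" where
  "adj_star S = {(u, v). {u, v} \<in> S}\<^sup>*"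

lemma adj_star_sym: "(u, v) \<in> adj_star S \<Longrightarrow> (v, u) \<in> adj_star S"
proof -
  have "sym {(u, v). {u, v} \<in> S}"
    by (auto simp: sym_def insert_commute)
  then show "(u, v) \<in> adj_star S \<Longrightarrow> (v, u) \<in> adj_star S"
    unfolding adj_star_def by (metis sym_rtrancl symD)
qed

lemma adj_star_trans: "(u, v) \<in> adj_star S \<Longrightarrow> (v, w) \<in> adj_star S \<Longrightarrow> (u, w) \<in> adj_star S"
  unfolding adj_star_def by (rule rtrancl_trans)

lemma adj_star_mono: "S \<subseteq> T \<Longrightarrow> adj_star S \<subseteq> adj_star T"
  unfolding adj_star_def by (rule rtrancl_mono) auto

lemma adj_star_edge: "{u, v} \<in> S \<Longrightarrow> (u, v) \<in> adj_star S"
  unfolding adj_star_def by auto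

lemma adj_star_refl: "(u, u) \<in> adj_star S"
  unfolding adj_star_def by auto

text \<open>Whenever the walk returns to a vertex it already contains, it is cut back to that
  vertex.\<close>

lemma adj_star_distinct_walk:
  assumes "(u, v) \<in> adj_star S"
  shows "\<exists>xs. xs \<noteq> [] \<and> hd xs = u \<and> last xs = v \<and> distinct xs \<and>
           (\<forall>i. Suc i < length xs \<longrightarrow> {xs ! i, xs ! Suc i} \<in> S)"
  using assms unfolding adj_star_def
proof (induction rule: rtrancl_induct)
  case base
  show ?case by (rule exI[of _ "[u]"]) auto
next
  case (step y z)
  then obtain xs where xs: "xs \<noteq> []" "hd xs = u" "last xs = y" "distinct xs"
    "\<And>i. Suc i < length xs \<Longrightarrow> {xs ! i, xs ! Suc i} \<in> S"
    by blast
  show ?case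
  proof (cases "z \<in> set xs")
    case True
    then obtain j where j: "j < length xs" "xs ! j = z"
      by (auto simp: in_set_conv_nth)
    show ?thesis
    proof (rule exI[of _ "take (Suc j) xs"], intro conjI allI impI)
      show "hd (take (Suc j) xs) = u"
        using xs by (cases xs) auto
      show "last (take (Suc j) xs) = z"
        using j by (simp add: take_Suc_conv_app_nth)
    qed (use xs j in auto)
  next
    case False
    show ?thesis
    proof (rule exI[of _ "xs @ [z]"], intro conjI allI impI)
      fix i assume i: "Suc i < length (xs @ [z])"
      show "{(xs @ [z]) ! i, (xs @ [z]) ! Suc i} \<in> S"
      proof (cases "Suc i < length xs")
        case True
        then show ?thesis using xs(5) by (simp add: nth_append)
      next
        case False
        then have "Suc i = length xs"
          using i by simp
        moreover from this have "i = length xs - 1"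
          by simp
        ultimately have "xs ! i = y" "(xs @ [z]) ! i = xs ! i" "(xs @ [z]) ! Suc i = z"
          using xs(1,3) by (auto simp: last_conv_nth nth_append)
        then show ?thesis
          using step.hyps(2) by simp
      qed
    qed (use xs False in auto)
  qed
qed

lemma is_cycle_insert_edge:
  assumes uv: "u \<noteq> v" "{u, v} \<notin> S" "(u, v) \<in> adj_star S"
  shows "\<exists>c. is_cycle (V, insert {u, v} S) c"
proof -
  obtain xs where xs: "xs \<noteq> []" "hd xs = u" "last xs = v" "distinct xs"
    "\<And>i. Suc i < length xs \<Longrightarrow> {xs ! i, xs ! Suc i} \<in> S"
    using adj_star_distinct_walk[OF uv(3)] by blast
  have ends: "xs ! 0 = u" "xs ! (length xs - 1) = v"
    using xs by (auto simp: hd_conv_nth last_conv_nth)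
  \<comment> \<open>One vertex would mean \<open>u = v\<close>, and two would make
    \<open>{u, v}\<close> an edge of \<open>S\<close>.\<close>
  have "length xs \<noteq> 0" "length xs \<noteq> 1" "length xs \<noteq> 2"
    using ends xs(1) uv xs(5)[of 0] by auto
  then have len: "3 \<le> length xs"
    by linarith
  have "{xs ! i, xs ! (Suc i mod length xs)} \<in> insert {u, v} S" if "i < length xs" for i
  proof (cases "Suc i < length xs")
    case True
    then show ?thesis using xs(5) by simp
  next
    case False
    then have "Suc i = length xs"
      using that by simp
    then have "i = length xs - 1" "Suc i mod length xs = 0"
      by auto
    then show ?thesis
      using ends by auto
  qed
  then show ?thesis
    unfolding is_cycle_def using len xs(4) by auto
qed

lemma is_cycle_four_edges:
  assumes c: "is_cycle G c" and len: "4 \<le> length c" and fin: "finite (edges G)"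
  shows "4 \<le> card (edges G)"
proof -
  \<comment> \<open>The end of the fourth edge: the start of the cycle if it has length four, a
    fifth vertex otherwise.\<close>
  let ?x = "c ! (4 mod length c)"
  have d: "distinct c" and e: "\<And>i. i < length c \<Longrightarrow> {c ! i, c ! (Suc i mod length c)} \<in> edges G"
    using c unfolding is_cycle_def by auto
  have x: "4 mod length c = 0 \<or> 4 mod length c = 4 \<and> 4 < length c"
    using len by (cases "length c = 4") auto
  have inE: "{{c ! 0, c ! 1}, {c ! 1, c ! 2}, {c ! 2, c ! 3}, {c ! 3, ?x}} \<subseteq> edges G"
  proof -
    have "Suc 0 mod length c = 1" "Suc 1 mod length c = 2" "Suc 2 mod length c = 3" "Suc 3 = 4"
      "0 < length c" "1 < length c" "2 < length c" "3 < length c"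
      using len by auto
    then have "{c ! 0, c ! 1} \<in> edges G" "{c ! 1, c ! 2} \<in> edges G" "{c ! 2, c ! 3} \<in> edges G"
      "{c ! 3, ?x} \<in> edges G"
      using e by metis+
    then show ?thesis by simp
  qed
  have ne: "c ! i \<noteq> c ! j" if "i < length c" "j < length c" "i \<noteq> j" for i j
    using that d by (simp add: nth_eq_iff_index_eq)
  have "?x \<noteq> c ! 1" "?x \<noteq> c ! 2" "?x \<noteq> c ! 3"
    by (rule ne; use x len in auto)+
  moreover have "c ! 0 \<noteq> c ! 1" "c ! 0 \<noteq> c ! 2" "c ! 0 \<noteq> c ! 3" "c ! 1 \<noteq> c ! 2" "c ! 1 \<noteq> c ! 3" "c ! 2 \<noteq> c ! 3"
    by (rule ne; use len in auto)+
  ultimately have "card {{c ! 0, c ! 1}, {c ! 1, c ! 2}, {c ! 2, c ! 3}, {c ! 3, ?x}} = 4"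
    by (auto simp: card_insert_if doubleton_eq_iff)
  then show ?thesis
    using card_mono[OF fin inE] by simp
qed

section \<open>Plane graphs and adding one edge\<close>

locale plane_graph =
  fixes V :: "'a set" and E :: "'a set set" and p :: "'a \<Rightarrow> complex" and \<gamma> :: "'a set \<Rightarrow> real \<Rightarrow> complex"
  assumes simple: "simple_graph (V, E)" and drawing: "planar_drawing (V, E) p \<gamma>"
begin

abbreviation curve :: "'a set \<Rightarrow> complex set" where
  "curve e \<equiv> path_image (\<gamma> e)"

text \<open>All vertices belong to the skeleton from the start, so a new curve meets the old
  skeleton in its two ends exactly.\<close>

definition skel :: "'a set set \<Rightarrow> complex set" where
  "skel S = p ` V \<union> (\<Union>e\<in>S. curve e)"

lemma finite_V: "finite V"
  using simple by (simp add: simple_graph_def)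

lemma edge_subset: "e \<in> E \<Longrightarrow> e \<subseteq> V"
  using simple by (simp add: simple_graph_def)

lemma edge_card: "e \<in> E \<Longrightarrow> card e = 2"
  using simple by (simp add: simple_graph_def)

lemma finite_E: "finite E"
  using finite_V edge_subset by (meson PowI finite_Pow_iff finite_subset subsetI)

lemma inj_p: "inj_on p V"
  using drawing by (simp add: planar_drawing_def)

lemma arc_curve: "e \<in> E \<Longrightarrow> arc (\<gamma> e)"
  using drawing by (simp add: planar_drawing_def)

lemma curve_ends: "e \<in> E \<Longrightarrow> {pathstart (\<gamma> e), pathfinish (\<gamma> e)} = p ` e"
  using drawing by (simp add: planar_drawing_def)

lemma curve_Int_points: "e \<in> E \<Longrightarrow> curve e \<inter> p ` V = p ` e"
  using drawing by (simp add: planar_drawing_def)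

lemma curve_Int_curve: "e \<in> E \<Longrightarrow> f \<in> E \<Longrightarrow> e \<noteq> f \<Longrightarrow> curve e \<inter> curve f = p ` (e \<inter> f)"
  using drawing by (simp add: planar_drawing_def)

lemma ends_in_curve: "e \<in> E \<Longrightarrow> p ` e \<subseteq> curve e"
  using curve_Int_points by blast

lemma compact_skel: "S \<subseteq> E \<Longrightarrow> compact (skel S)"
  unfolding skel_def using finite_V finite_E
  by (intro compact_Un compact_UN)
    (auto intro: finite_subset compact_arc_image arc_curve finite_imp_compact)

lemma skel_insert: "skel (insert e S) = skel S \<union> curve e"
  by (auto simp: skel_def)

lemma skel_mono: "S \<subseteq> T \<Longrightarrow> skel S \<subseteq> skel T"
  by (auto simp: skel_def)

lemma curve_Int_skel:
  assumes "S \<subseteq> E" "e \<in> E" "e \<notin> S"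
  shows "curve e \<inter> skel S = p ` e"
proof
  show "curve e \<inter> skel S \<subseteq> p ` e"
  proof
    fix x assume x: "x \<in> curve e \<inter> skel S"
    then consider "x \<in> p ` V" | f where "f \<in> S" "x \<in> curve f"
      by (auto simp: skel_def)
    then show "x \<in> p ` e"
    proof cases
      case 1
      then show ?thesis using x curve_Int_points[OF assms(2)] by blast
    next
      case 2
      then have "x \<in> p ` (e \<inter> f)"
        using x assms curve_Int_curve[of e f] by blast
      then show ?thesis by blast
    qed
  qed
  show "p ` e \<subseteq> curve e \<inter> skel S"
    using ends_in_curve[OF assms(2)] edge_subset[OF assms(2)] by (auto simp: skel_def)
qed

lemma adj_star_path_component:
  assumes S: "S \<subseteq> E" and uv: "(u, v) \<in> adj_star S" and u: "u \<in> V"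
  shows "path_component (skel S) (p u) (p v)"
  using uv unfolding adj_star_def
proof (induction rule: rtrancl_induct)
  case base
  show ?case using u by (auto simp: skel_def intro: path_component_refl)
next
  case (step y z)
  then have e: "{y, z} \<in> S" "{y, z} \<in> E"
    using S by auto
  have "path_connected (curve {y, z})"
    using arc_curve[OF e(2)] by (simp add: arc_imp_path path_connected_path_image)
  then have "path_component (curve {y, z}) (p y) (p z)"
    using ends_in_curve[OF e(2)] by (auto simp: path_connected_component)
  then have "path_component (skel S) (p y) (p z)"
    using e(1) by (auto simp: skel_def intro: path_component_of_subset)
  then show ?case
    using step.IH path_component_trans by blast
qed

text \<open>
  The components of the graph split its skeleton into two disjoint compact sets, each of which
  meets the new edge in one point only, so two applications of Janiszewski's theorem suffice.
\<close>

lemma bridge_no_separation: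
  assumes S: "S \<subseteq> E" and e: "{u, v} \<in> E" "{u, v} \<notin> S" and uv: "(u, v) \<notin> adj_star S"
    and ab: "connected_component (- skel S) a b" "a \<notin> curve {u, v}" "b \<notin> curve {u, v}"
  shows "connected_component (- skel (insert {u, v} S)) a b"
proof -
  define R where "R = {w \<in> V. (u, w) \<in> adj_star S}"
  define P where "P = p ` R \<union> (\<Union>f\<in>{f \<in> S. f \<subseteq> R}. curve f)"
  define Q where "Q = p ` (V - R) \<union> (\<Union>f\<in>{f \<in> S. \<not> f \<subseteq> R}. curve f)"
  have uV: "u \<in> V" "v \<in> V"
    using edge_subset[OF e(1)] by auto
  have uR: "u \<in> R" and vR: "v \<notin> R"
    using uV uv by (auto simp: R_def adj_star_refl)
  have edge_dichotomy: "f \<inter> R = {}" if f: "f \<in> S" "\<not> f \<subseteq> R" for f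
  proof -
    have fE: "f \<in> E" using f S by blast
    then obtain x y where xy: "f = {x, y}" "x \<in> V" "y \<in> V"
      using edge_card[OF fE] edge_subset[OF fE] by (auto simp: card_2_iff)
    then have "(x, y) \<in> adj_star S" "(y, x) \<in> adj_star S"
      using f(1) by (auto intro!: adj_star_edge simp: insert_commute)
    then have "x \<in> R \<longleftrightarrow> y \<in> R"
      using xy by (auto simp: R_def intro: adj_star_trans)
    then show ?thesis
      using f(2) xy by auto
  qed
  have YPQ: "skel S = P \<union> Q"
    unfolding skel_def P_def Q_def R_def by auto
  have cP: "compact P" and cQ: "compact Q"
    unfolding P_def Q_def R_def using finite_V finite_subset[OF S finite_E] S
    by (intro compact_Un compact_UN; auto intro: compact_arc_image arc_curve finite_imp_compact)+
  have eP: "curve {u, v} \<inter> P \<subseteq> {p u}"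
  proof
    fix x assume x: "x \<in> curve {u, v} \<inter> P"
    then consider r where "r \<in> R" "x = p r" | f where "f \<in> S" "f \<subseteq> R" "x \<in> curve f"
      by (auto simp: P_def)
    then show "x \<in> {p u}"
    proof cases
      case 1
      then have "x \<in> p ` {u, v}"
        using x curve_Int_points[OF e(1)] by (auto simp: R_def)
      then show ?thesis
        using 1 vR uV inj_p by (auto simp: R_def inj_on_def)
    next
      case 2
      then have "x \<in> p ` ({u, v} \<inter> f)"
        using x curve_Int_curve[OF e(1), of f] S e(2) by blast
      then show ?thesis using 2 vR by auto
    qed
  qed
  have eQ: "curve {u, v} \<inter> Q \<subseteq> {p v}"
  proof
    fix x assume x: "x \<in> curve {u, v} \<inter> Q"
    then consider r where "r \<in> V - R" "x = p r" | f where "f \<in> S" "\<not> f \<subseteq> R" "x \<in> curve f"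
      by (auto simp: Q_def)
    then show "x \<in> {p v}"
    proof cases
      case 1
      then have "x \<in> p ` {u, v}"
        using x curve_Int_points[OF e(1)] by auto
      then show ?thesis
        using 1 uR uV inj_p by (auto simp: inj_on_def)
    next
      case 2
      then have "x \<in> p ` ({u, v} \<inter> f)"
        using x curve_Int_curve[OF e(1), of f] S e(2) by blast
      then show ?thesis using edge_dichotomy[OF 2(1,2)] uR by auto
    qed
  qed
  have PQ: "P \<inter> Q = {}"
  proof -
    have d1: "p ` R \<inter> p ` (V - R) = {}"
      using inj_p by (auto simp: R_def inj_on_def)
    have d2: "p ` R \<inter> curve f = {}" if "f \<in> S" "\<not> f \<subseteq> R" for f
    proof -
      have "p ` R \<inter> p ` f = p ` (R \<inter> f)"
        using edge_subset that S by (intro inj_on_image_Int[OF inj_p, symmetric]) (auto simp: R_def)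
      moreover have "R \<inter> f = {}" "R \<subseteq> V"
        using edge_dichotomy[OF that] by (auto simp: R_def)
      ultimately show ?thesis
        using curve_Int_points[of f] that S by blast
    qed
    have d3: "p ` (V - R) \<inter> curve f = {}" if "f \<in> S" "f \<subseteq> R" for f
    proof -
      have "p ` (V - R) \<inter> p ` f = p ` ((V - R) \<inter> f)"
        using edge_subset that S by (intro inj_on_image_Int[OF inj_p, symmetric]) auto
      moreover have "(V - R) \<inter> f = {}"
        using that by blast
      ultimately show ?thesis
        using curve_Int_points[of f] that S by blast
    qed
    have d4: "curve f \<inter> curve g = {}" if "f \<in> S" "f \<subseteq> R" "g \<in> S" "\<not> g \<subseteq> R" for f g
      using edge_dichotomy[OF that(3,4)] curve_Int_curve[of f g] that S by blast
    show ?thesis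
    proof (rule equals0I)
      fix x assume "x \<in> P \<inter> Q"
      then consider "x \<in> p ` R" "x \<in> p ` (V - R)"
        | f where "f \<in> S" "\<not> f \<subseteq> R" "x \<in> p ` R" "x \<in> curve f"
        | f where "f \<in> S" "f \<subseteq> R" "x \<in> p ` (V - R)" "x \<in> curve f"
        | f g where "f \<in> S" "f \<subseteq> R" "g \<in> S" "\<not> g \<subseteq> R" "x \<in> curve f" "x \<in> curve g"
        unfolding P_def Q_def by blast
      then show False
      proof cases
        case 1
        then show ?thesis using d1 by blast
      next
        case 2
        then show ?thesis using d2[of f] by blast
      next
        case 3
        then show ?thesis using d3[of f] by blast
      next
        case 4
        then show ?thesis using d4[of f g] by blast
      qed
    qed
  qed
  have pv: "p v \<in> curve {u, v}" "p v \<in> Q"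
    using ends_in_curve[OF e(1)] uV vR by (auto simp: Q_def)
  have pu: "p u \<in> curve {u, v}" "p u \<in> P"
    using ends_in_curve[OF e(1)] uR by (auto simp: P_def)
  have mono: "connected_component (- P) a b" "connected_component (- Q) a b"
    using ab(1) unfolding YPQ by (auto elim!: connected_component_of_subset)
  have cc: "compact (curve {u, v})"
    using arc_curve[OF e(1)] by (rule compact_arc_image)
  \<comment> \<open>A single arc does not separate the plane; from here \<open>P\<close> and then
    \<open>Q\<close> are added by Janiszewski's theorem.\<close>
  have "connected (- curve {u, v})"
    using connected_arc_complement[OF arc_curve[OF e(1)]] by simp
  then have "connected_component (- curve {u, v}) a b"
    using ab(2,3) by (auto simp: connected_iff_connected_component)
  moreover have "curve {u, v} \<inter> P = {p u}"
    using eP pu by auto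
  ultimately have "connected_component (- (curve {u, v} \<union> P)) a b"
    using mono cP cc by (intro Janiszewski) (auto simp: compact_imp_closed)
  moreover have "(curve {u, v} \<union> P) \<inter> Q = {p v}"
    using eQ pv PQ by auto
  ultimately have "connected_component (- ((curve {u, v} \<union> P) \<union> Q)) a b"
    using mono cP cQ cc
    by (intro Janiszewski[of "curve {u, v} \<union> P" Q]) (auto simp: compact_imp_closed compact_Un)
  moreover have "(curve {u, v} \<union> P) \<union> Q = skel (insert {u, v} S)"
    unfolding skel_insert YPQ by auto
  ultimately show ?thesis by simp
qed

text \<open>
  The new edge closes up to a Jordan curve whose intersection with the old skeleton is an arc, so
  Janiszewski's theorem shows that each old face is cut into its inside and its outside part only.
\<close>

lemma cycle_edge_two_sides:
  assumes S: "S \<subseteq> E" and e: "{u, v} \<in> E" "{u, v} \<notin> S" and uv: "(u, v) \<in> adj_star S"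
  obtains A B where "open A" "open B" "A \<inter> B = {}" "- skel (insert {u, v} S) \<subseteq> A \<union> B"
    "curve {u, v} \<subseteq> frontier A" "curve {u, v} \<subseteq> frontier B"
    "\<And>a b. connected_component (- skel S) a b \<Longrightarrow> a \<in> A \<and> b \<in> A \<or> a \<in> B \<and> b \<in> B \<Longrightarrow>
       connected_component (- skel (insert {u, v} S)) a b"
proof -
  let ?g = "\<gamma> {u, v}"
  define x y where "x = pathstart ?g" and "y = pathfinish ?g"
  have uvV: "u \<in> V" "v \<in> V"
    using edge_subset[OF e(1)] by auto
  have xy: "{x, y} = {p u, p v}"
    using curve_ends[OF e(1)] by (simp add: x_def y_def)
  have "x \<noteq> y"
    using arc_distinct_ends[OF arc_curve[OF e(1)]] by (simp add: x_def y_def)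
  have "path_component (skel S) (p u) (p v)"
    using adj_star_path_component[OF S uv uvV(1)] .
  then have "path_component (skel S) y x"
    using xy path_component_sym \<open>x \<noteq> y\<close> by (metis doubleton_eq_iff)
  then obtain h where h: "arc h" "path_image h \<subseteq> skel S" "pathstart h = y" "pathfinish h = x"
  proof -
    assume *: "\<And>h. arc h \<Longrightarrow> path_image h \<subseteq> skel S \<Longrightarrow> pathstart h = y \<Longrightarrow> pathfinish h = x \<Longrightarrow> thesis"
    have pc: "path_connected (path_component_set (skel S) y)"
      by simp
    have "y \<in> path_component_set (skel S) y" "x \<in> path_component_set (skel S) y"
      using \<open>path_component (skel S) y x\<close> path_component_mem by (auto intro: path_component_refl)
    then obtain h where "arc h" "path_image h \<subseteq> path_component_set (skel S) y"
      "pathstart h = y" "pathfinish h = x"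
      using pc \<open>x \<noteq> y\<close> unfolding path_connected_arcwise by metis
    then show thesis
      using * path_component_subset by blast
  qed
  have Int: "curve {u, v} \<inter> skel S = {x, y}"
    using curve_Int_skel[OF S e] xy by simp
  have loop: "simple_path (?g +++ h)"
  proof (rule simple_path_join_loop)
    show "curve {u, v} \<inter> path_image h \<subseteq> {pathstart ?g, pathstart h}"
      using Int h by (auto simp: x_def)
  qed (use h arc_curve[OF e(1)] in \<open>auto simp: x_def y_def\<close>)
  define C where "C = path_image (?g +++ h)"
  have C: "C = curve {u, v} \<union> path_image h"
    unfolding C_def using h by (simp add: path_image_join y_def)
  have closedloop: "pathfinish (?g +++ h) = pathstart (?g +++ h)"
    using h by (simp add: x_def)
  have J: "open (inside C)" "connected (inside C)" "open (outside C)" "connected (outside C)"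
    "inside C \<inter> outside C = {}" "inside C \<union> outside C = - C" "frontier (inside C) = C" "frontier (outside C) = C"
    using Jordan_inside_outside[OF loop closedloop] unfolding C_def by auto
  have compactC: "compact C"
    unfolding C_def using loop by (simp add: compact_simple_path_image)
  have CS: "C \<inter> skel S = path_image h"
  proof -
    have "{x, y} \<subseteq> path_image h"
      using h pathstart_in_path_image[of h] pathfinish_in_path_image[of h] by auto
    then show ?thesis
      using Int h(2) unfolding C by blast
  qed
  have CSu: "C \<union> skel S = skel (insert {u, v} S)"
    using h unfolding skel_insert C by auto
  show thesis
  proof (rule that)
    show "- skel (insert {u, v} S) \<subseteq> inside C \<union> outside C"
      using J(6) CSu by auto
    \<comment> \<open>Both sides of a Jordan curve have the whole curve as frontier, so the new edge
      borders each of them.\<close>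
    show "curve {u, v} \<subseteq> frontier (inside C)" "curve {u, v} \<subseteq> frontier (outside C)"
      using J C by auto
    fix a b assume ab: "connected_component (- skel S) a b"
      "a \<in> inside C \<and> b \<in> inside C \<or> a \<in> outside C \<and> b \<in> outside C"
    have "connected_component (- C) a b"
      using ab(2) J(2,4,6) unfolding connected_component_def by blast
    moreover have "connected (C \<inter> skel S)"
      unfolding CS using h(1) by (simp add: connected_arc_image)
    ultimately have "connected_component (- (C \<union> skel S)) a b"
      using compactC compact_skel[OF S] ab(1) by (intro Janiszewski) (auto simp: compact_imp_closed)
    then show "connected_component (- skel (insert {u, v} S)) a b"
      by (simp add: CSu)
  qed (use J in auto)
qed

section \<open>Counting faces from below\<close>

definition inner :: "'a set \<Rightarrow> complex set" where
  "inner e = curve e - p ` e"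

text \<open>The open arc of the new edge is connected and misses the old skeleton, so adding the
  edge affects one old face only.\<close>

lemma inner_subset_face:
  assumes S: "S \<subseteq> E" and e: "e \<in> E" "e \<notin> S"
  obtains x where "x \<in> inner e" "inner e \<subseteq> connected_component_set (- skel S) x"
proof -
  have inner: "inner e = curve e - {pathstart (\<gamma> e), pathfinish (\<gamma> e)}"
    unfolding inner_def using curve_ends[OF e(1)] by simp
  have sp: "simple_path (\<gamma> e)"
    using arc_curve[OF e(1)] by (rule arc_imp_simple_path)
  have "connected (inner e)" "inner e \<noteq> {}"
    unfolding inner using connected_simple_path_endless[OF sp] nonempty_simple_path_endless[OF sp] by auto
  moreover have "inner e \<subseteq> - skel S"
    using curve_Int_skel[OF S e] by (auto simp: inner_def)
  ultimately show thesis
    using that connected_component_maximal by (metis ex_in_conv)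
qed

text \<open>An arc is homeomorphic to an interval, so a nonempty open set of the plane inside it
  would embed into the line, against invariance of dimension. Every face therefore has points off a
  given edge.\<close>

lemma open_not_subset_curve:
  assumes "open U" "U \<noteq> {}" "e \<in> E"
  shows "\<not> U \<subseteq> curve e"
proof
  assume U: "U \<subseteq> curve e"
  have "continuous_on {0..1} (\<gamma> e)" "inj_on (\<gamma> e) {0..1}"
    using arc_curve[OF assms(3)] by (auto simp: arc_def path_def)
  then obtain g where g: "homeomorphism {0..1} (curve e) (\<gamma> e) g"
    using homeomorphism_compact[of "{0..1::real}" "\<gamma> e" "curve e"] by (auto simp: path_image_def)
  have "continuous_on U g" "inj_on g U"
    using g U unfolding homeomorphism_def
    by (auto intro: continuous_on_subset intro!: inj_on_inverseI[of U "\<gamma> e" g])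
  then have "DIM(complex) \<le> DIM(real)"
    using assms(1,2) by (intro invariance_of_dimension[of U g])
  then show False by simp
qed

text \<open>At most one point per face, so the size of \<open>W\<close> is a lower bound for the
  number of faces.\<close>

definition separated_points :: "'a set set \<Rightarrow> complex set \<Rightarrow> bool" where
  "separated_points S W \<longleftrightarrow> finite W \<and> W \<subseteq> - skel S \<and>
     (\<forall>a\<in>W. \<forall>b\<in>W. a \<noteq> b \<longrightarrow> \<not> connected_component (- skel S) a b)"

text \<open>Equal labels certify a connection in \<open>S\<close>. The labels in use take the place
  of the components in Euler's formula.\<close>

definition component_labelling :: "'a set set \<Rightarrow> ('a \<Rightarrow> 'a) \<Rightarrow> bool" where
  "component_labelling S lab \<longleftrightarrow> (\<forall>u\<in>V. \<forall>v\<in>V. lab u = lab v \<longrightarrow> (u, v) \<in> adj_star S)"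

text \<open>The lower half of Euler's formula, by adding edges. The face \<open>U\<close> that
  contains the new edge gives up its point and receives two if the ends carry equal labels, since
  the edge then closes a cycle. Otherwise it receives one, and two labels are merged.\<close>

lemma many_faces:
  assumes "S \<subseteq> E"
  shows "\<exists>W lab. separated_points S W \<and> component_labelling S lab \<and>
     card S + card (lab ` V) + 1 \<le> card W + card V"
proof -
  have "finite S"
    using assms finite_E finite_subset by blast
  then show ?thesis
    using assms
  proof (induction S rule: finite_induct)
    case empty
    have "p ` V \<noteq> UNIV"
      using finite_V infinite_UNIV_char_0[where ?'a = complex] by (metis finite_imageI)
    then obtain z where "z \<notin> p ` V" by auto
    then show ?case
      by (intro exI[of _ "{z}"] exI[of _ id])
        (auto simp: separated_points_def component_labelling_def skel_def adj_star_refl)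
  next
    case (insert e S)
    then have S: "S \<subseteq> E" and e: "e \<in> E" "e \<notin> S" by auto
    obtain W lab where Wlab: "separated_points S W" "component_labelling S lab"
      and count: "card S + card (lab ` V) + 1 \<le> card W + card V"
      using insert.IH[OF S] by (elim exE conjE)
    have W: "finite W" "W \<subseteq> - skel S"
        "\<And>a b. a \<in> W \<Longrightarrow> b \<in> W \<Longrightarrow> a \<noteq> b \<Longrightarrow> \<not> connected_component (- skel S) a b"
      using Wlab(1) by (auto simp: separated_points_def)
    have lab: "(u, v) \<in> adj_star S" if "u \<in> V" "v \<in> V" "lab u = lab v" for u v
      using Wlab(2) that by (auto simp: component_labelling_def)
    obtain u v where uv: "e = {u, v}" "u \<noteq> v" "u \<in> V" "v \<in> V"
      using edge_card[OF e(1)] edge_subset[OF e(1)] by (auto simp: card_2_iff)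
    obtain x where x: "x \<in> inner e" and inU: "inner e \<subseteq> connected_component_set (- skel S) x"
      using inner_subset_face[OF S e] by blast
    define U where "U = connected_component_set (- skel S) x"
    have openU: "open U"
      unfolding U_def using compact_skel[OF S]
      by (intro open_connected_component) (simp add: compact_imp_closed open_Compl)
    have xU: "x \<in> U"
      using x inU U_def by auto
    have USkel: "U \<inter> skel S = {}"
      unfolding U_def using connected_component_subset by fastforce
    have same: "connected_component (- skel S) a b" if "a \<in> U" "b \<in> U" for a b
      using that unfolding U_def by (auto intro: connected_component_sym connected_component_trans)
    have down: "connected_component (- skel S) a b" if "connected_component (- skel (insert e S)) a b" for a b
      using that skel_mono[of S "insert e S"] by (auto elim!: connected_component_of_subset)
    have curveU: "curve e \<subseteq> U \<union> skel S"
      using inU curve_Int_skel[OF S e] by (auto simp: inner_def U_def)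
    have WU: "W - U \<subseteq> - skel (insert e S)"
      using W(2) curveU by (auto simp: skel_insert)
    \<comment> \<open>\<open>U\<close> is a single face, so at most one point is given up.\<close>
    have cardWU: "card W \<le> card (W - U) + 1"
    proof -
      have "card (W \<inter> U) \<le> 1"
        using W(1,3) same by (intro card_le_Suc0_iff_eq[THEN iffD2, unfolded One_nat_def[symmetric]]) auto
      moreover have "card W = card (W \<inter> U) + card (W - U)"
        using W(1) by (metis card_Int_Diff)
      ultimately show ?thesis by simp
    qed
    have sepU: "\<not> connected_component (- skel (insert e S)) w a"
      "\<not> connected_component (- skel (insert e S)) a w" if "w \<in> W - U" "a \<in> U" for w a
    proof -
      have "\<not> connected_component (- skel S) a w"
        using that unfolding U_def by (auto dest: connected_component_trans)
      then show "\<not> connected_component (- skel (insert e S)) w a"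
        "\<not> connected_component (- skel (insert e S)) a w"
        using down connected_component_sym by blast+
    qed
    have sepW: "\<not> connected_component (- skel (insert e S)) a b" if "a \<in> W - U" "b \<in> W - U" "a \<noteq> b" for a b
      using W(3) down that by blast
    show ?case
    proof (cases "lab u = lab v")
      case True
      then have "(u, v) \<in> adj_star S"
        using lab uv by blast
      then obtain A B where AB: "open A" "open B" "A \<inter> B = {}" "- skel (insert e S) \<subseteq> A \<union> B"
        "curve e \<subseteq> frontier A" "curve e \<subseteq> frontier B"
        using cycle_edge_two_sides[OF S, of u v] e unfolding uv(1) by metis
      \<comment> \<open>\<open>x\<close> lies on the frontier of both sides of the Jordan curve, so
        the open face \<open>U\<close> reaches into both.\<close>
      have "x \<in> closure A" "x \<in> closure B"
        using AB x by (auto simp: inner_def frontier_def)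
      then obtain a b where ab: "a \<in> A" "a \<in> U" "b \<in> B" "b \<in> U"
        using openU xU by (metis disjoint_iff open_Int_closure_eq_empty)
      have abY: "{a, b} \<subseteq> - skel (insert e S)"
        using ab AB USkel frontier_disjoint_eq[of A] frontier_disjoint_eq[of B] by (auto simp: skel_insert)
      have "a \<noteq> b"
        using ab AB by auto
      have sepab: "\<not> connected_component (- skel (insert e S)) a b"
      proof
        assume "connected_component (- skel (insert e S)) a b"
        then obtain T where T: "connected T" "T \<subseteq> - skel (insert e S)" "a \<in> T" "b \<in> T"
          unfolding connected_component_def by blast
        then have "A \<inter> B \<inter> T = {}" "T \<subseteq> A \<union> B" "A \<inter> T \<noteq> {}" "B \<inter> T \<noteq> {}"
          using AB ab by auto
        then show False
          using T(1) AB(1,2) unfolding connected_def by blast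
      qed
      have sepba: "\<not> connected_component (- skel (insert e S)) b a"
        using sepab connected_component_sym by blast
      let ?W = "insert a (insert b (W - U))"
      have "card ?W = card (W - U) + 2"
        using W(1) ab \<open>a \<noteq> b\<close> by simp
      then have "card (insert e S) + card (lab ` V) + 1 \<le> card ?W + card V"
        using count cardWU insert.hyps by simp
      moreover have "separated_points (insert e S) ?W"
        unfolding separated_points_def
      proof (intro conjI ballI impI)
        fix c d assume "c \<in> ?W" "d \<in> ?W" "c \<noteq> d"
        then show "\<not> connected_component (- skel (insert e S)) c d"
          using sepab sepba sepU ab sepW by blast
      qed (use W(1) abY WU in auto)
      moreover have "component_labelling (insert e S) lab"
        using lab adj_star_mono[of S "insert e S"] by (auto simp: component_labelling_def)
      ultimately show ?thesis by blast
    next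
      case False
      \<comment> \<open>The lost label pays for the new edge, while the number of points does not
        drop.\<close>
      define lab' where "lab' z = (if lab z = lab u then lab v else lab z)" for z
      have uvadj: "(u, v) \<in> adj_star (insert e S)" "(v, u) \<in> adj_star (insert e S)"
        using uv(1) by (auto intro: adj_star_edge adj_star_sym)
      have lab_ins: "(y, z) \<in> adj_star (insert e S)" if "y \<in> V" "z \<in> V" "lab y = lab z" for y z
        using lab[OF that] adj_star_mono[of S "insert e S"] by blast
      have "component_labelling (insert e S) lab'"
        unfolding component_labelling_def
      proof (intro ballI impI)
        fix y z assume yz: "y \<in> V" "z \<in> V" "lab' y = lab' z"
        consider "lab y = lab z" | "lab y = lab u" "lab z = lab v" | "lab y = lab v" "lab z = lab u"
          using yz(3) by (auto simp: lab'_def split: if_splits)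
        then show "(y, z) \<in> adj_star (insert e S)"
        proof cases
          case 1
          then show ?thesis using lab_ins yz by blast
        next
          case 2
          then show ?thesis
            using lab_ins[of y u] lab_ins[of v z] uvadj(1) uv yz by (auto intro: adj_star_trans)
        next
          case 3
          then show ?thesis
            using lab_ins[of y v] lab_ins[of u z] uvadj(2) uv yz by (auto intro: adj_star_trans)
        qed
      qed
      moreover have "card (lab' ` V) + 1 = card (lab ` V)"
      proof -
        have "lab' ` V = lab ` V - {lab u}"
          using uv False unfolding lab'_def by (auto simp: image_iff)
        then show ?thesis
          using uv finite_V card_Suc_Diff1[of "lab ` V" "lab u"] by auto
      qed
      \<comment> \<open>The old point of \<open>U\<close> may lie on the new curve, so one off the
        curve takes its place.\<close>
      moreover obtain a where a: "a \<in> U" "a \<notin> curve e"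
        using open_not_subset_curve[OF openU _ e(1)] xU by blast
      let ?W = "insert a (W - U)"
      have "card ?W = card (W - U) + 1"
        using W(1) a by simp
      moreover have "separated_points (insert e S) ?W"
        unfolding separated_points_def
      proof (intro conjI ballI impI)
        fix c d assume "c \<in> ?W" "d \<in> ?W" "c \<noteq> d"
        then show "\<not> connected_component (- skel (insert e S)) c d"
          using sepU a sepW by blast
      qed (use W(1) a USkel WU in \<open>auto simp: skel_insert\<close>)
      ultimately show ?thesis
        using count cardWU insert.hyps by (intro exI[of _ ?W] exI[of _ lab']) auto
    qed
  qed
qed

section \<open>Edges bordering a face\<close>

lemma acyclic_no_separation:
  assumes "S \<subseteq> E" "\<nexists>c. is_cycle (V, S) c" "a \<notin> skel S" "b \<notin> skel S"
  shows "connected_component (- skel S) a b"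
proof -
  have "finite S"
    using assms finite_E finite_subset by blast
  then show ?thesis
    using assms
  proof (induction S rule: finite_induct)
    case empty
    have "connected (UNIV - p ` V)"
      using finite_V by (intro connected_open_diff_countable) (auto intro: countable_finite)
    then show ?case
      using empty by (auto simp: skel_def connected_iff_connected_component Compl_eq_Diff_UNIV)
  next
    case (insert e S)
    then have S: "S \<subseteq> E" and e: "e \<in> E" "e \<notin> S" by auto
    obtain u v where uv: "e = {u, v}" "u \<noteq> v"
      using edge_card[OF e(1)] by (auto simp: card_2_iff)
    have "\<nexists>c. is_cycle (V, S) c"
      using insert.prems(2) unfolding is_cycle_def by auto
    then have "connected_component (- skel S) a b"
      using insert.IH S insert.prems by (auto simp: skel_insert)
    \<comment> \<open>A connection of the ends in \<open>S\<close> would close a cycle with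
      \<open>e\<close>, so every edge added is a bridge.\<close>
    moreover have "(u, v) \<notin> adj_star S"
      using is_cycle_insert_edge[of u v S V] uv e insert.prems(2) by auto
    ultimately show ?case
      using bridge_no_separation[OF S, of u v a b] e insert.prems unfolding uv(1) by (auto simp: skel_insert)
  qed
qed

text \<open>Only points of the open arc count: an edge that touches the frontier just at a vertex
  does not border the face.\<close>

definition face_edges :: "complex \<Rightarrow> 'a set set" where
  "face_edges w = {e \<in> E. inner e \<inter> frontier (connected_component_set (- skel E) w) \<noteq> {}}"

text \<open>A connected set that leaves the face of \<open>w\<close> meets its frontier. As faces
  are open, frontier points lie on the skeleton, and each is a vertex or an inner point of an edge
  in \<open>face_edges w\<close>.\<close>

lemma face_edges_separate:
  assumes w: "w \<notin> skel E" and nc: "\<not> connected_component (- skel E) w w'"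
  shows "\<not> connected_component (- skel (face_edges w)) w w'"
proof
  assume "connected_component (- skel (face_edges w)) w w'"
  then obtain T where T: "connected T" "T \<subseteq> - skel (face_edges w)" "w \<in> T" "w' \<in> T"
    unfolding connected_component_def by blast
  define F where "F = connected_component_set (- skel E) w"
  have "w \<in> F" "w' \<notin> F"
    using w nc by (auto simp: F_def)
  then have "T \<inter> frontier F \<noteq> {}"
    using T by (intro connected_Int_frontier) auto
  then obtain y where y: "y \<in> T" "y \<in> frontier F" by blast
  have "open (- skel E)"
    using compact_skel[of E] by (simp add: compact_imp_closed open_Compl)
  have "y \<in> skel E"
  proof (rule ccontr)
    assume ny: "y \<notin> skel E"
    let ?F' = "connected_component_set (- skel E) y"
    have op: "open ?F'" "open F"
      using \<open>open (- skel E)\<close> by (auto simp: F_def open_connected_component)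
    then have "y \<notin> F" "y \<in> closure F"
      using y(2) by (auto simp: frontier_def interior_open)
    then obtain z where "z \<in> ?F'" "z \<in> F"
      using op(1) ny by (metis ComplI connected_component_refl disjoint_iff mem_Collect_eq open_Int_closure_eq_empty)
    then have "connected_component (- skel E) w y"
      unfolding F_def by (auto intro: connected_component_sym connected_component_trans)
    then show False
      using \<open>y \<notin> F\<close> by (simp add: F_def)
  qed
  then consider "y \<in> p ` V" | e where "e \<in> E" "y \<in> inner e"
    unfolding skel_def inner_def using edge_subset by blast
  then have "y \<in> skel (face_edges w)"
  proof cases
    case 2
    then have "e \<in> face_edges w" "y \<in> curve e"
      using y(2) by (auto simp: face_edges_def F_def inner_def)
    then show ?thesis by (auto simp: skel_def)
  qed (simp add: skel_def)
  then show False
    using T y by auto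
qed

text \<open>When \<open>e\<close> is deleted, all faces it borders merge into the face
  \<open>U\<close> around its open arc. Putting \<open>e\<close> back leaves points of
  \<open>U\<close> connected if they are on the same side of the Jordan curve, or in any case if
  \<open>e\<close> is a bridge. So among three points two would share a face.\<close>

lemma face_edges_at_most_two:
  assumes e: "e \<in> E" and W: "finite W" "W \<subseteq> - skel E"
    "\<And>a b. a \<in> W \<Longrightarrow> b \<in> W \<Longrightarrow> a \<noteq> b \<Longrightarrow> \<not> connected_component (- skel E) a b"
  shows "card {w \<in> W. e \<in> face_edges w} \<le> 2"
proof (rule ccontr)
  assume "\<not> ?thesis"
  then have "3 \<le> card {w \<in> W. e \<in> face_edges w}" by simp
  then obtain Z where Z: "Z \<subseteq> {w \<in> W. e \<in> face_edges w}" "card Z = 3"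
    by (meson obtain_subset_with_card_n)
  then obtain a b c where abc: "Z = {a, b, c}" "a \<noteq> b" "a \<noteq> c" "b \<noteq> c"
    by (auto simp: card_3_iff)
  define S where "S = E - {e}"
  have S: "S \<subseteq> E" "e \<notin> S" "insert e S = E"
    using e by (auto simp: S_def)
  obtain x where x: "inner e \<subseteq> connected_component_set (- skel S) x"
    using inner_subset_face[OF S(1) e S(2)] by blast
  define U where "U = connected_component_set (- skel S) x"
  have openU: "open U"
    unfolding U_def using compact_skel[OF S(1)]
    by (intro open_connected_component) (simp add: compact_imp_closed open_Compl)
  have inU: "w \<in> U" if w: "w \<in> Z" for w
  proof -
    let ?F = "connected_component_set (- skel E) w"
    have wW: "w \<in> W" "e \<in> face_edges w"
      using w Z by auto
    then obtain y where y: "y \<in> inner e" "y \<in> closure ?F"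
      unfolding face_edges_def frontier_def by blast
    then have "y \<in> U"
      using x U_def by blast
    then obtain z where z: "z \<in> U" "z \<in> ?F"
      using openU y(2) by (metis disjoint_iff open_Int_closure_eq_empty)
    have "connected_component (- skel S) w z"
      using z(2) skel_mono[OF S(1)] by (auto elim!: connected_component_of_subset)
    then show ?thesis
      using z(1) unfolding U_def by (auto intro: connected_component_sym connected_component_trans)
  qed
  have same: "connected_component (- skel S) w w'" if "w \<in> Z" "w' \<in> Z" for w w'
    using inU[OF that(1)] inU[OF that(2)] unfolding U_def
    by (auto intro: connected_component_sym connected_component_trans)
  have sep: "\<not> connected_component (- skel (insert e S)) w w'" if "w \<in> Z" "w' \<in> Z" "w \<noteq> w'" for w w'
    using that Z W(3) S(3) by auto
  have ZY: "Z \<subseteq> - skel (insert e S)"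
    using Z W(2) S(3) by auto
  obtain u v where uv: "e = {u, v}"
    using edge_card[OF e] by (auto simp: card_2_iff)
  show False
  proof (cases "(u, v) \<in> adj_star S")
    case True
    then obtain A B where AB: "- skel (insert e S) \<subseteq> A \<union> B"
      "\<And>a b. connected_component (- skel S) a b \<Longrightarrow> a \<in> A \<and> b \<in> A \<or> a \<in> B \<and> b \<in> B \<Longrightarrow>
       connected_component (- skel (insert e S)) a b"
      using cycle_edge_two_sides[OF S(1), of u v] e S(2) unfolding uv by metis
    have "{a, b, c} \<subseteq> A \<union> B"
      using ZY AB(1) abc by auto
    then have "a \<in> A \<and> b \<in> A \<or> a \<in> B \<and> b \<in> B \<or> a \<in> A \<and> c \<in> A \<or> a \<in> B \<and> c \<in> B \<or> b \<in> A \<and> c \<in> A \<or> b \<in> B \<and> c \<in> B"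
      by blast
    then show ?thesis
      using AB(2) same sep abc by (metis insertCI)
  next
    case False
    have "a \<notin> curve e" "b \<notin> curve e" "connected_component (- skel S) a b"
      using ZY same abc by (auto simp: skel_insert)
    then have "connected_component (- skel (insert e S)) a b"
      using bridge_no_separation[OF S(1), of u v a b] False e S(2) unfolding uv by blast
    then show ?thesis
      using sep abc by auto
  qed
qed

theorem card_edges_le:
  assumes girth: "4 \<le> girth (V, E)" and V: "3 \<le> card V"
  shows "card E + 4 \<le> 2 * card V"
proof -
  obtain W lab where "separated_points E W" "component_labelling E lab"
    and count: "card E + card (lab ` V) + 1 \<le> card W + card V"
    using many_faces[OF order_refl] by (elim exE conjE)
  then have W: "finite W" "W \<subseteq> - skel E"
      "\<And>a b. a \<in> W \<Longrightarrow> b \<in> W \<Longrightarrow> a \<noteq> b \<Longrightarrow> \<not> connected_component (- skel E) a b"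
    by (auto simp: separated_points_def)
  have "card (lab ` V) \<noteq> 0"
    using V finite_V by auto
  then have count': "card E + 2 \<le> card W + card V"
    using count by linarith
  show ?thesis
  \<comment> \<open>With at most one point \<open>count'\<close> gives
    \<open>card E <= card V - 1\<close>, which suffices because \<open>3 <= card V\<close>.
    Otherwise each point has another one in a different face.\<close>
  proof (cases "card W \<le> 1")
    case True
    then show ?thesis using count' V by linarith
  next
    case False
    have four: "4 \<le> card (face_edges w)" if w: "w \<in> W" for w
    proof -
      \<comment> \<open>The edges around the face of \<open>w\<close> separate it from
        \<open>w'\<close>. Acyclic edge sets do not separate, so there is a cycle among them, of
        length at least four by the girth.\<close>
      obtain w' where w': "w' \<in> W" "w' \<noteq> w"
        using False W(1) card_le_Suc0_iff_eq[OF W(1)] w by (metis One_nat_def)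
      have sub: "face_edges w \<subseteq> E"
        by (auto simp: face_edges_def)
      have "w \<notin> skel (face_edges w)" "w' \<notin> skel (face_edges w)"
        using w w' W(2) skel_mono[OF sub] by auto
      moreover have "\<not> connected_component (- skel (face_edges w)) w w'"
        using face_edges_separate[of w w'] W w w' by auto
      ultimately obtain c where c: "is_cycle (V, face_edges w) c"
        using acyclic_no_separation[OF sub] by blast
      then have "is_cycle (V, E) c"
        using sub unfolding is_cycle_def by auto
      then have "girth (V, E) \<le> enat (length c)"
        unfolding girth_def by (intro INF_lower) auto
      then have "4 \<le> length c"
        using girth by (metis enat_ord_simps(1) numeral_eq_enat order_trans)
      then show ?thesis
        using is_cycle_four_edges[OF c] finite_subset[OF sub finite_E] by simp
    qed
    \<comment> \<open>Incidences of edges and faces are counted in two ways.\<close>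
    have "4 * card W \<le> (\<Sum>w\<in>W. card (face_edges w))"
      using sum_mono[of W "\<lambda>_. 4" "\<lambda>w. card (face_edges w)"] four by simp
    also have "\<dots> = (\<Sum>w\<in>W. \<Sum>e\<in>E. if e \<in> face_edges w then 1 else 0)"
      by (intro sum.cong) (auto simp: sum.If_cases finite_E face_edges_def Int_def conj_commute intro: arg_cong[where f = card])
    also have "\<dots> = (\<Sum>e\<in>E. \<Sum>w\<in>W. if e \<in> face_edges w then 1 else 0)"
      by (rule sum.swap)
    also have "\<dots> = (\<Sum>e\<in>E. card {w \<in> W. e \<in> face_edges w})"
      by (intro sum.cong) (auto simp: sum.If_cases W(1) Int_def)
    also have "\<dots> \<le> (\<Sum>e\<in>E. 2)"
      by (intro sum_mono face_edges_at_most_two W)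
    finally have "4 * card W \<le> 2 * card E" by simp
    then show ?thesis using count' by linarith
  qed
qed

end

text \<open>Members of a decomposition may have fewer than three vertices, where
  \<open>2 * card V - 4\<close> is no valid bound. Stated with \<open>N\<close> it holds uniformly,
  as such a graph has at most one edge.\<close>

lemma planar_girth4_card_edges:
  assumes "simple_graph H" "planar H" "4 \<le> girth H" "card (verts H) \<le> N" "4 \<le> N"
  shows "card (edges H) + 4 \<le> 2 * N"
proof -
  obtain V E where H: "H = (V, E)" by (cases H)
  obtain p \<gamma> where "planar_drawing (V, E) p \<gamma>"
    using assms(2) H unfolding planar_def by blast
  then interpret plane_graph V E p \<gamma>
    using assms(1) H by unfold_locales auto
  show ?thesis
  proof (cases "3 \<le> card V")
    case True
    then show ?thesis
      using card_edges_le assms H by simp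
  next
    case False
    have "finite V" and E: "\<And>e. e \<in> E \<Longrightarrow> e \<subseteq> V \<and> card e = 2"
      using assms(1) H by (auto simp: simple_graph_def)
    have "e = V" if "e \<in> E" for e
      using E[OF that] \<open>finite V\<close> False by (intro card_seteq) auto
    then have "E \<subseteq> {V}" by auto
    then have "card E \<le> 1"
      using card_mono[of "{V}" E] by simp
    then show ?thesis
      using assms(5) H by simp
  qed
qed

section \<open>Complete multipartite graphs\<close>

lemma card_edges_complete_multipartite:
  "card (edges (complete_multipartite m s)) = (\<Sum>(i, j)\<in>{(i, j). 1 \<le> i \<and> i < j \<and> j \<le> m}. s i * s j)"
proof -
  let ?P = "{(i, j). 1 \<le> i \<and> i < j \<and> j \<le> m}"
  \<comment> \<open>An edge is coded by the increasing pair of its parts and the positions of its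
    ends in them; the order of the parts makes the code unique.\<close>
  let ?D = "SIGMA q:?P. {1..s (fst q)} \<times> {1..s (snd q)}"
  let ?f = "\<lambda>(q, r). {(fst q, fst r), (snd q, snd r)}"
  have "?P \<subseteq> {..m} \<times> {..m}"
    by auto
  then have finP: "finite ?P"
    by (rule finite_subset) simp
  have inj: "inj_on ?f ?D"
    by (auto simp: inj_on_def doubleton_eq_iff)
  have image: "?f ` ?D = edges (complete_multipartite m s)"
  proof
    show "?f ` ?D \<subseteq> edges (complete_multipartite m s)"
      by (force simp: complete_multipartite_def Let_def)
    show "edges (complete_multipartite m s) \<subseteq> ?f ` ?D"
    proof
      fix e assume "e \<in> edges (complete_multipartite m s)"
      then obtain i a j b where e: "e = {(i, a), (j, b)}" "i \<noteq> j"
        and ab: "i \<in> {1..m}" "j \<in> {1..m}" "a \<in> {1..s i}" "b \<in> {1..s j}"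
        by (auto simp: complete_multipartite_def Let_def)
      show "e \<in> ?f ` ?D"
      proof (cases "i < j")
        case True
        then show ?thesis
          using e ab by (intro image_eqI[of _ _ "((i, j), (a, b))"]) auto
      next
        case False
        then show ?thesis
          using e ab by (intro image_eqI[of _ _ "((j, i), (b, a))"]) auto
      qed
    qed
  qed
  have "card (edges (complete_multipartite m s)) = card ?D"
    using card_image[OF inj] unfolding image .
  also have "\<dots> = (\<Sum>q\<in>?P. s (fst q) * s (snd q))"
    using finP by (subst card_SigmaI) auto
  also have "\<dots> = (\<Sum>(i, j)\<in>?P. s i * s j)"
    by (intro sum.cong) auto
  finally show ?thesis .
qed

lemma card_verts_complete_multipartite:
  "card (verts (complete_multipartite m s)) = (\<Sum>i=1..m. s i)"
  by (simp add: complete_multipartite_def Let_def)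

theorem theorem2:
  fixes m :: nat and ns :: "nat \<Rightarrow> nat" and n e :: nat
  assumes "m \<ge> 2"
    and "\<forall>i\<in>{1..m}. ns i > 0"
    and "n = (\<Sum>i=1..m. ns i)"
    and "e = (\<Sum>(i, j)\<in>{(i, j). 1 \<le> i \<and> i < j \<and> j \<le> m}. ns i * ns j)"
  shows "girth_thickness 4 (complete_multipartite m (\<lambda>i. 2 * ns i)) =
    enat (nat \<lceil>real e / (real n - 1)\<rceil>)"
proof -
  define G where "G = complete_multipartite m (\<lambda>i. 2 * ns i)"
  define V0 where "V0 = (SIGMA i:{1..m}. {1..ns i})"
  define E0 where "E0 = {{u, v} | u v. u \<in> V0 \<and> v \<in> V0 \<and> fst u \<noteq> fst v}"
  have base: "complete_multipartite m ns = (V0, E0)"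
    by (simp add: complete_multipartite_def V0_def E0_def Let_def)
  have cV0: "card V0 = n" and cE0: "card E0 = e"
    using card_verts_complete_multipartite[of m ns] card_edges_complete_multipartite[of m ns] assms(3,4) base by auto
  have cV: "card (verts G) = 2 * n"
    unfolding G_def card_verts_complete_multipartite by (simp add: assms(3) sum_distrib_left)
  have cE: "card (edges G) = 4 * e"
    unfolding G_def card_edges_complete_multipartite assms(4) sum_distrib_left by (intro sum.cong) auto
  have "ns 1 + ns 2 \<le> n"
  proof -
    have "ns 1 + ns 2 = sum ns {1, 2}" by simp
    also have "\<dots> \<le> n"
      unfolding assms(3) using assms(1) by (intro sum_mono2) auto
    finally show ?thesis .
  qed
  moreover have "0 < ns 1" "0 < ns 2"
    using assms(1,2) by auto
  ultimately have n: "2 \<le> n" by linarith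
  have "e > 0"
  proof -
    have "(1, 1) \<in> V0" "(2, 1) \<in> V0"
      unfolding V0_def using assms(1) \<open>0 < ns 1\<close> \<open>0 < ns 2\<close> by auto
    then have "{(1, 1), (2, 1)} \<in> E0"
      unfolding E0_def by fastforce
    moreover have "finite E0"
      using simple_graph_complete_multipartite[of m ns] unfolding base simple_graph_def
      by (auto intro: finite_subset[of _ "Pow V0"])
    ultimately show ?thesis
      using cE0 card_gt_0_iff by blast
  qed
  define k where "k = nat \<lceil>real e / (real n - 1)\<rceil>"
  \<comment> \<open>The ceiling as an adjunction: the lower bound uses it for an arbitrary
    \<open>j\<close>, the upper bound for \<open>j = k\<close>.\<close>
  have k_le: "k \<le> j \<longleftrightarrow> e \<le> j * (n - 1)" for j
  proof -
    have "k \<le> j \<longleftrightarrow> real e / (real n - 1) \<le> real j"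
      unfolding k_def by (simp add: nat_le_iff ceiling_le_iff)
    also have "\<dots> \<longleftrightarrow> real e \<le> real j * (real n - 1)"
      using n by (simp add: pos_divide_le_eq)
    also have "\<dots> \<longleftrightarrow> real e \<le> real (j * (n - 1))"
      using n by (simp add: of_nat_diff)
    finally show ?thesis
      by (simp only: of_nat_le_iff)
  qed
  have "girth_thickness 4 G \<ge> enat k"
    unfolding girth_thickness_def
  proof (rule INF_greatest)
    fix j assume "j \<in> {k. \<exists>H. planar_girth_decomposition 4 G k H}"
    then obtain H where H: "\<And>i. i < j \<Longrightarrow> subgraph (H i) G \<and> planar (H i) \<and> 4 \<le> girth (H i)"
      "(\<Union>i<j. edges (H i)) = edges G"
      unfolding planar_girth_decomposition_def by (auto simp: numeral_eq_enat)
    have finV: "finite (verts G)"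
      using cV n card.infinite by fastforce
    have "card (edges (H i)) \<le> 4 * (n - 1)" if "i < j" for i
    proof -
      have "card (verts (H i)) \<le> 2 * n"
        using H(1)[OF that] finV cV by (metis card_mono subgraph_def)
      then have "card (edges (H i)) + 4 \<le> 2 * (2 * n)"
        using H(1)[OF that] n by (intro planar_girth4_card_edges) (auto simp: subgraph_def)
      then show ?thesis by simp
    qed
    then have "(\<Sum>i<j. card (edges (H i))) \<le> (\<Sum>i<j. 4 * (n - 1))"
      by (intro sum_mono) auto
    moreover have "card (edges G) \<le> (\<Sum>i<j. card (edges (H i)))"
      unfolding H(2)[symmetric] by (rule card_UN_le) simp
    ultimately have "4 * e \<le> 4 * (j * (n - 1))"
      using cE by simp
    then show "enat k \<le> enat j"
      using k_le by simp
  qed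
  moreover have "girth_thickness 4 G \<le> enat k"
  proof -
    have "\<exists>S. (\<forall>i<k. S i \<subseteq> E0 \<and> forest (S i)) \<and> (\<Union>i<k. S i) = E0"
    proof (rule forest_cover[of V0])
      show "finite V0"
        by (simp add: V0_def)
      show "x \<subseteq> V0 \<and> card x = 2" if "x \<in> E0" for x
        using that simple_graph_complete_multipartite[of m ns] unfolding base simple_graph_def by auto
      show "card {x \<in> E0. x \<subseteq> C} \<le> k * (card C - 1)" if "C \<subseteq> V0" "C \<noteq> {}" for C
        using multipartite_dense[OF \<open>finite V0\<close> E0_def _ that] k_le[of k] cV0 cE0 by simp
    qed
    then obtain S where S: "\<And>i. i < k \<Longrightarrow> S i \<subseteq> E0" "\<And>i. i < k \<Longrightarrow> forest (S i)" "(\<Union>i<k. S i) = E0"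
      by blast
    \<comment> \<open>The copies of vertex \<open>t\<close> of a part are the vertices
      \<open>2 t - 1\<close> and \<open>2 t\<close>, as numbering starts at one. Parity tells them
      apart.\<close>
    define \<pi> :: "nat \<times> nat \<Rightarrow> nat \<times> nat" where "\<pi> u = (fst u, (snd u + 1) div 2)" for u
    define H where "H i = (verts G, {{u, v} | u v. u \<in> verts G \<and> v \<in> verts G \<and> {\<pi> u, \<pi> v} \<in> S i})" for i
    have vG: "verts G = (SIGMA i:{1..m}. {1..2 * ns i})"
      by (simp add: G_def complete_multipartite_def Let_def)
    have eG: "edges G = {{u, v} | u v. u \<in> verts G \<and> v \<in> verts G \<and> fst u \<noteq> fst v}"
      by (simp add: G_def complete_multipartite_def Let_def)
    have \<pi>_V0: "\<pi> u \<in> V0" if "u \<in> verts G" for u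
      using that unfolding vG V0_def \<pi>_def by auto
    have fst_ne: "fst u \<noteq> fst v" if "{\<pi> u, \<pi> v} \<in> E0" for u v
      using that unfolding E0_def \<pi>_def by (auto simp: doubleton_eq_iff)
    have edge_H: "{\<pi> u, \<pi> v} \<in> S i" if "{u, v} \<in> edges (H i)" for u v i
      using that unfolding H_def by (auto simp: doubleton_eq_iff insert_commute)
    have sub: "subgraph (H i) G" if "i < k" for i
    proof -
      have "edges (H i) \<subseteq> edges G"
        using S(1)[OF that] fst_ne unfolding H_def eG by auto blast
      moreover have "verts (H i) = verts G"
        by (simp add: H_def)
      moreover have "simple_graph G"
        unfolding G_def by (rule simple_graph_complete_multipartite)
      ultimately show ?thesis
        unfolding subgraph_def simple_graph_def by auto
    qed
    have "planar (H i)" if "i < k" for i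
    proof (rule planar_forest_blowup[OF S(2)[OF that], where \<pi> = \<pi> and right = "\<lambda>u. even (snd u)"])
      show "simple_graph (H i)"
        using sub[OF that] by (simp add: subgraph_def)
      show "inj_on (\<lambda>u. (\<pi> u, even (snd u))) (verts (H i))"
      proof (rule inj_onI)
        fix u v assume "(\<pi> u, even (snd u)) = (\<pi> v, even (snd v))"
        then have "fst u = fst v" "(snd u + 1) div 2 = (snd v + 1) div 2" "even (snd u) = even (snd v)"
          by (auto simp: \<pi>_def)
        moreover from this(2,3) have "snd u = snd v"
          by presburger
        ultimately show "u = v"
          by (simp add: prod_eq_iff)
      qed
    qed (use edge_H in auto)
    moreover have "4 \<le> girth (H i)" if "i < k" for i
      using S(2)[OF that] edge_H by (rule girth_forest_blowup)
    moreover have "(\<Union>i<k. verts (H i)) = verts G"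
    proof -
      \<comment> \<open>An empty decomposition would not cover the vertices; \<open>e > 0\<close>
        excludes it.\<close>
      have "k \<noteq> 0"
        using k_le[of 0] \<open>e > 0\<close> by auto
      then show ?thesis by (auto simp: H_def)
    qed
    moreover have "(\<Union>i<k. edges (H i)) = edges G"
    proof
      show "(\<Union>i<k. edges (H i)) \<subseteq> edges G"
        using sub by (auto simp: subgraph_def)
      show "edges G \<subseteq> (\<Union>i<k. edges (H i))"
      proof
        fix x assume "x \<in> edges G"
        then obtain u v where uv: "x = {u, v}" "u \<in> verts G" "v \<in> verts G" "fst u \<noteq> fst v"
          unfolding eG by blast
        then have "\<pi> u \<in> V0" "\<pi> v \<in> V0" "fst (\<pi> u) \<noteq> fst (\<pi> v)"
          using \<pi>_V0 by (auto simp: \<pi>_def)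
        then have "{\<pi> u, \<pi> v} \<in> E0"
          unfolding E0_def by blast
        then obtain i where "i < k" "{\<pi> u, \<pi> v} \<in> S i"
          using S(3) by blast
        then have "x \<in> edges (H i)"
          unfolding H_def snd_conv using uv by blast
        then show "x \<in> (\<Union>i<k. edges (H i))"
          using \<open>i < k\<close> by blast
      qed
    qed
    ultimately have "planar_girth_decomposition 4 G k H"
      unfolding planar_girth_decomposition_def using sub by (simp add: numeral_eq_enat)
    then show ?thesis
      unfolding girth_thickness_def by (intro INF_lower) blast
  qed
  ultimately show ?thesis
    unfolding G_def k_def by (rule antisym[rotated])
qed

end
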